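(* The elements $t_1t_2\cdots t_k$, for $k\in\{0,1,\dots,n\}$ (with the empty product equal to $1$ for $k=0$), form a complete set of representatives of the $\mathcal{B}_n$-orbits in the set of planar words of $\Sigma_{0,1,n}$. That is, every planar word lies in the $\mathcal{B}_n$-orbit of $t_1\cdots t_k$ for exactly one $k$.
   Context: $\Sigma_{0,1,n}$ is the free group on $t_1,\dots,t_n$, with $\overline t_k=t_k^{-1}$ and $z_1=(t_1\cdots t_n)^{-1}$. Automorphisms act on the right. $\mathcal{B}_n$ is the group of automorphisms of $\Sigma_{0,1,n}$ fixing $z_1$ and permuting the conjugacy classes $\{[t_1],\dots,[t_n]\}$; it acts on $\Sigma_{0,1,n}$ and preserves the set of planar words. Let $A$ be the set of formal symbols $\overline z_1,t_1,\overline t_1,\dots,t_n,\overline t_n,z_1$, ordered by $\overline z_1<t_1<\overline t_1<\dots<t_n<\overline t_n<z_1$. For a reduced word $a_1\cdots a_m$, its Whitehead expansion is $(c_1,\dots,c_{2m+2})=(\overline z_1,a_1,\overline a_1,\dots,a_m,\overline a_m,z_1)$. Two $2$-element sets of integers $\{a,b\},\{c,d\}$ are nested if $a,b,c,d$ are distinct and either both or neither of $c,d$ lie strictly between $a$ and $b$. A $2M$-tuple $(c_1,\dots,c_{2M})$ of elements of $A$ is planar if some permutation $\pi$ of $\{1,\dots,2M\}$ satisfies three conditions: - $\pi(i)<\pi(j)\Rightarrow c_i\le c_j$; - the sets $\{\pi(2i-1),\pi(2i)\}$, $1\le i\le M$, are pairwise nested; - the sets $\{\pi(2i),\pi(2i+1)\}$,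 $1\le i\le M-1$, are pairwise nested. A word $w$ is planar if the Whitehead expansion of its reduced word is planar. *)

theory Defs
  imports Main
begin

text \<open>The free group \<Sigma>_{0,1,n} on t_1,...,t_n, realised on reduced words.
  A letter (i, False) stands for t_i, a letter (i, True) for its inverse.\<close>

type_synonym letter = "nat \<times> bool"
type_synonym word = "letter list"

definition inv_letter :: "letter \<Rightarrow> letter" where
  "inv_letter x = (fst x, \<not> snd x)"

definition inv_word :: "word \<Rightarrow> word" where
  "inv_word w = rev (map inv_letter w)"

fun reduced :: "word \<Rightarrow> bool" where
  "reduced [] = True"
| "reduced [x] = True"
| "reduced (x # y # ys) = (y \<noteq> inv_letter x \<and> reduced (y # ys))"

fun cancel :: "letter \<Rightarrow> word \<Rightarrow> word" where
  "cancel x [] = [x]"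
| "cancel x (y # ys) = (if y = inv_letter x then ys else x # y # ys)"

definition reduce :: "word \<Rightarrow> word" where
  "reduce w = foldr cancel w []"

definition carrier :: "nat \<Rightarrow> word set" where
  "carrier n = {w. reduced w \<and> (\<forall>x\<in>set w. fst x \<in> {1..n})}"

definition mult :: "word \<Rightarrow> word \<Rightarrow> word" where
  "mult u v = reduce (u @ v)"

definition gen :: "nat \<Rightarrow> word" where
  "gen i = [(i, False)]"

definition tprod :: "nat \<Rightarrow> word" where
  "tprod k = map (\<lambda>i. (i, False)) [1..<Suc k]"

definition z1 :: "nat \<Rightarrow> word" where
  "z1 n = inv_word (tprod n)"

definition ext :: "(nat \<Rightarrow> word) \<Rightarrow> word \<Rightarrow> word" where
  "ext f w = reduce (concat (map (\<lambda>x. if snd x then inv_word (f (fst x)) else f (fst x)) w))"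

definition conjugate :: "nat \<Rightarrow> word \<Rightarrow> word \<Rightarrow> bool" where
  "conjugate n u v = (\<exists>g\<in>carrier n. mult (mult g u) (inv_word g) = v)"

definition conj_class :: "nat \<Rightarrow> word \<Rightarrow> word set" where
  "conj_class n u = {v \<in> carrier n. conjugate n u v}"

text \<open>B_n, given by the images of the generators: automorphisms of \<Sigma>_{0,1,n}
  fixing z_1 and permuting the set of conjugacy classes {[t_1],...,[t_n]}.\<close>
definition Bn :: "nat \<Rightarrow> (nat \<Rightarrow> word) set" where
  "Bn n = {f. (\<forall>i\<in>{1..n}. f i \<in> carrier n)
             \<and> bij_betw (ext f) (carrier n) (carrier n)
             \<and> ext f (z1 n) = z1 n
             \<and> (\<lambda>i. conj_class n (ext f (gen i))) ` {1..n} = (\<lambda>i. conj_class n (gen i)) ` {1..n}}"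

definition orbit :: "nat \<Rightarrow> word \<Rightarrow> word set" where
  "orbit n u = {ext f u | f. f \<in> Bn n}"

text \<open>Alphabet A encoded by naturals: \<bar>z_1 = 0, t_i = 2i-1, \<bar>t_i = 2i, z_1 = 2n+1;
  the numeric order is the order of A.\<close>
definition code :: "letter \<Rightarrow> nat" where
  "code x = (if snd x then 2 * fst x else 2 * fst x - 1)"

definition whitehead :: "nat \<Rightarrow> word \<Rightarrow> nat list" where
  "whitehead n w = [0] @ concat (map (\<lambda>a. [code a, code (inv_letter a)]) w) @ [2 * n + 1]"

definition between :: "nat \<Rightarrow> nat \<Rightarrow> nat \<Rightarrow> bool" where
  "between a b x = (min a b < x \<and> x < max a b)"

definition nested :: "nat \<Rightarrow> nat \<Rightarrow> nat \<Rightarrow> nat \<Rightarrow> bool" where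
  "nested a b c d = (distinct [a, b, c, d] \<and> (between a b c \<longleftrightarrow> between a b d))"

definition planar_tuple :: "nat list \<Rightarrow> bool" where
  "planar_tuple cs = (even (length cs) \<and>
     (let M = length cs div 2; c = (\<lambda>i. cs ! (i - 1)) in
      \<exists>\<pi>. bij_betw \<pi> {1..2*M} {1..2*M}
        \<and> (\<forall>i\<in>{1..2*M}. \<forall>j\<in>{1..2*M}. \<pi> i < \<pi> j \<longrightarrow> c i \<le> c j)
        \<and> (\<forall>i\<in>{1..M}. \<forall>j\<in>{1..M}. i \<noteq> j \<longrightarrow>
              nested (\<pi> (2*i-1)) (\<pi> (2*i)) (\<pi> (2*j-1)) (\<pi> (2*j)))
        \<and> (\<forall>i\<in>{1..M-1}. \<forall>j\<in>{1..M-1}. i \<noteq> j \<longrightarrow>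
              nested (\<pi> (2*i)) (\<pi> (2*i+1)) (\<pi> (2*j)) (\<pi> (2*j+1)))))"

definition planar_word :: "nat \<Rightarrow> word \<Rightarrow> bool" where
  "planar_word n w = planar_tuple (whitehead n w)"

end

theory Submission
  imports Defs "HOL-Library.Product_Lexorder"
begin

text \<open>
  A planar word describes a simple arc in a disc with \<open>n\<close> punctures, cut open along rays
  \<open>r\<^sub>1, \<dots>, r\<^sub>n\<close> ending at the punctures: a letter is a crossing with a ray, and the pieces between
  consecutive crossings are pairwise disjoint chords of the resulting polygon.

  Suppose that some chord joins the left sides of two rays \<open>r\<^sub>i\<close> and \<open>r\<^sub>j\<close>, \<open>i < j\<close>, and that no chord
  below it joins two right sides. Every right side of \<open>r\<^sub>i, \<dots>, r\<^sub>j\<^sub>-\<^sub>1\<close> lies below that chord, so these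
  points are ends of distinct chords below it, and replacing \<open>r\<^sub>j\<close> by a ray that passes to the left of
  \<open>r\<^sub>i\<close> lowers the number of crossings. On words this is the braid \<open>t\<^sub>l \<mapsto> t\<^sub>i t\<^sub>l\<^sub>+\<^sub>1 t\<^sub>i\<^sup>-\<^sup>1\<close>
  (\<open>i \<le> l < j\<close>), \<open>t\<^sub>j \<mapsto> t\<^sub>i\<close>. An innermost chord joining two equal sides is of this kind up to
  reflection, so by induction only words with letters of a single sign remain. Counting ends below
  chords shows that such a word is positive, uses every letter at most once, and is increasing;
  further moves of the same kind turn it into \<open>t\<^sub>1 \<cdots> t\<^sub>k\<close>. The exponent sum determines \<open>k\<close>.
\<close>

section \<open>Free groups and braid automorphisms\<close>

text \<open>No topology enters: a simple arc is a word whose crossings carry integer heights, and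
  disjointness of its chords is a condition on a linear order. The obstacle is that the new ray
  ought to be drawn tight, and following all cancellations on a curve would be laborious. Existence
  and length are therefore separated. The moved curve is written out letter by letter, with three
  crossings for one of a ray that is passed over; it spells the substituted word exactly, and
  removing innermost bigons leaves a curve for the reduced word. The length is estimated on words
  alone: a reduced word is no longer than any word for the same group element, so a partly cancelled
  word gives the bound. Automorphisms travel with an explicit inverse, because the shortening steps
  start from the given word and have to be undone in order to reach it from
  \<open>tprod k\<close>.\<close>

lemma inv_letter_inv_letter [simp]: "inv_letter (inv_letter x) = x"
  by (simp add: inv_letter_def)

lemma fst_inv_letter [simp]: "fst (inv_letter x) = fst x"
  by (simp add: inv_letter_def)

lemma inv_letter_neq [simp]: "inv_letter x \<noteq> x" "x \<noteq> inv_letter x"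
  by (auto simp: inv_letter_def prod_eq_iff)

lemma inv_letter_eq_iff [simp]: "inv_letter x = inv_letter y \<longleftrightarrow> x = y"
  by (metis inv_letter_inv_letter)

lemma inv_letter_Pair [simp]: "inv_letter (i, b) = (i, \<not> b)"
  by (simp add: inv_letter_def)

lemma reduced_tl: "reduced (x # xs) \<Longrightarrow> reduced xs"
  by (cases xs) auto

lemma reduced_Cons: "reduced (x # xs) \<longleftrightarrow> reduced xs \<and> (xs = [] \<or> hd xs \<noteq> inv_letter x)"
  by (cases xs) auto

lemma reduced_cancel: "reduced w \<Longrightarrow> reduced (cancel x w)"
  by (cases w) (auto dest: reduced_tl)

text \<open>Van der Waerden's argument: letters act on reduced words by permutations, so the action
  of a word, and with it reduction, is compatible with concatenation.\<close>

lemma cancel_cancel_inv: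
  assumes "reduced w"
  shows "cancel x (cancel (inv_letter x) w) = w"
proof (cases w)
  case (Cons y ys)
  then show ?thesis using assms by (cases ys) auto
qed simp

lemma reduced_foldr_cancel: "reduced v \<Longrightarrow> reduced (foldr cancel u v)"
  by (induction u) (auto intro: reduced_cancel)

lemma reduced_reduce [simp]: "reduced (reduce w)"
  by (simp add: reduce_def reduced_foldr_cancel)

lemma foldr_cancel_cancel:
  assumes "reduced v"
  shows "foldr cancel (cancel x u) v = cancel x (foldr cancel u v)"
proof (cases u)
  case (Cons y ys)
  then show ?thesis using assms by (auto simp: cancel_cancel_inv reduced_foldr_cancel)
qed simp

lemma foldr_cancel_reduce: "reduced v \<Longrightarrow> foldr cancel (reduce u) v = foldr cancel u v"
  by (induction u) (simp_all add: reduce_def foldr_cancel_cancel)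

lemma reduce_append: "reduce (u @ v) = foldr cancel u (reduce v)"
  by (simp add: reduce_def)

lemma reduce_Nil [simp]: "reduce [] = []"
  by (simp add: reduce_def)

lemma reduce_Cons: "reduce (x # w) = cancel x (reduce w)"
  by (simp add: reduce_def)

lemma reduce_reduced: "reduced w \<Longrightarrow> reduce w = w"
proof (induction w)
  case (Cons x w)
  then show ?case by (cases w) (auto simp: reduce_Cons dest: reduced_tl)
qed simp

lemma length_reduce_le: "length (reduce w) \<le> length w"
proof (induction w)
  case (Cons x w)
  have "length (cancel x u) \<le> Suc (length u)" for u by (cases u) auto
  then show ?case using Cons by (simp add: reduce_Cons) (meson Suc_le_mono order_trans)
qed simp

lemma set_reduce_subset: "set (reduce w) \<subseteq> set w"
proof (induction w)
  case (Cons x w)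
  have "set (cancel x u) \<subseteq> insert x (set u)" for u by (cases u) auto
  then show ?case using Cons by (fastforce simp: reduce_Cons)
qed simp

section \<open>Equality in the free group as a congruence on unreduced words\<close>

definition feq :: "word \<Rightarrow> word \<Rightarrow> bool" (infix \<open>\<approx>\<close> 50) where
  "u \<approx> v \<longleftrightarrow> reduce u = reduce v"

lemma feq_refl [simp, intro]: "u \<approx> u"
  by (simp add: feq_def)

lemma feq_sym: "u \<approx> v \<Longrightarrow> v \<approx> u"
  by (simp add: feq_def)

lemma feq_trans [trans]: "u \<approx> v \<Longrightarrow> v \<approx> w \<Longrightarrow> u \<approx> w"
  by (simp add: feq_def)

lemma feq_reduce [simp]: "reduce w \<approx> w" "w \<approx> reduce w"
  by (simp_all add: feq_def reduce_reduced)

lemma feq_append: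
  assumes "u \<approx> u'" "v \<approx> v'"
  shows "u @ v \<approx> u' @ v'"
proof -
  have "foldr cancel u (reduce v) = foldr cancel u' (reduce v)"
    using assms(1) foldr_cancel_reduce[of "reduce v" u] foldr_cancel_reduce[of "reduce v" u']
    by (simp add: feq_def)
  then show ?thesis using assms(2) by (simp add: feq_def reduce_append)
qed

lemma inv_word_Nil [simp]: "inv_word [] = []"
  by (simp add: inv_word_def)

lemma inv_word_Cons: "inv_word (x # w) = inv_word w @ [inv_letter x]"
  by (simp add: inv_word_def)

lemma inv_word_append: "inv_word (u @ v) = inv_word v @ inv_word u"
  by (simp add: inv_word_def)

lemma inv_word_inv_word [simp]: "inv_word (inv_word w) = w"
  by (simp add: inv_word_def rev_map o_def)

lemma set_inv_word: "set (inv_word w) = inv_letter ` set w"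
  by (simp add: inv_word_def)

lemma feq_cancel_pair: "x # inv_letter x # w \<approx> w"
  by (simp add: feq_def reduce_Cons cancel_cancel_inv)

lemma feq_cancel_pair': "inv_letter x # x # w \<approx> w"
  using feq_cancel_pair[of "inv_letter x"] by simp

lemma append_inv_word_feq: "w @ inv_word w \<approx> []"
proof (induction w)
  case (Cons x w)
  have "(x # w) @ inv_word (x # w) = [x] @ (w @ inv_word w) @ [inv_letter x]"
    by (simp add: inv_word_Cons)
  also have "\<dots> \<approx> [x] @ [] @ [inv_letter x]"
    using Cons by (intro feq_append) auto
  also have "\<dots> \<approx> []" using feq_cancel_pair[of x "[]"] by simp
  finally show ?case .
qed simp

lemma inv_word_append_feq: "inv_word w @ w \<approx> []"
  using append_inv_word_feq[of "inv_word w"] by simp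

lemma inv_word_cancel_feq: "inv_word w @ w @ u \<approx> u" "w @ inv_word w @ u \<approx> u"
  using feq_append[OF inv_word_append_feq feq_refl, of w u]
    feq_append[OF append_inv_word_feq feq_refl, of w u] by simp_all

lemma inv_word_feq:
  assumes "u \<approx> v"
  shows "inv_word u \<approx> inv_word v"
proof -
  have "inv_word u \<approx> inv_word u @ v @ inv_word v"
    using feq_append[OF feq_refl append_inv_word_feq, of "inv_word u" v] by (simp add: feq_sym)
  also have "\<dots> \<approx> inv_word u @ u @ inv_word v"
    using assms by (intro feq_append) (auto intro: feq_sym)
  also have "\<dots> \<approx> inv_word v" by (rule inv_word_cancel_feq)
  finally show ?thesis .
qed

text \<open>\<open>ext\<close> without its final reduction. On words this is strictly
  multiplicative, so identities are proved here modulo \<open>\<approx>\<close> and reduced only at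
  the end.\<close>

definition subst :: "(nat \<Rightarrow> word) \<Rightarrow> word \<Rightarrow> word" where
  "subst f w = concat (map (\<lambda>x. if snd x then inv_word (f (fst x)) else f (fst x)) w)"

lemma ext_eq: "ext f w = reduce (subst f w)"
  by (simp add: ext_def subst_def)

lemma subst_Nil [simp]: "subst f [] = []"
  by (simp add: subst_def)

lemma subst_Cons: "subst f (x # w) = (if snd x then inv_word (f (fst x)) else f (fst x)) @ subst f w"
  by (simp add: subst_def)

lemma subst_append: "subst f (u @ v) = subst f u @ subst f v"
  by (simp add: subst_def)

lemma subst_inv_word: "subst f (inv_word w) = inv_word (subst f w)"
  by (induction w) (simp_all add: inv_word_Cons subst_append subst_Cons inv_word_append inv_letter_def)

lemma subst_gen: "subst f (gen i) = f i"
  by (simp add: gen_def subst_Cons)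

lemma subst_cancel_feq: "subst f (cancel x w) \<approx> subst f (x # w)"
proof (cases w)
  case (Cons y ys)
  show ?thesis
  proof (cases "y = inv_letter x")
    case True
    then have "subst f (x # w) = subst f [x] @ inv_word (subst f [x]) @ subst f ys"
      using Cons by (simp add: subst_Cons inv_letter_def)
    then show ?thesis using inv_word_cancel_feq(2)[of "subst f [x]" "subst f ys"] True Cons
      by (simp add: feq_sym)
  qed (simp add: Cons)
qed simp

lemma subst_reduce_feq: "subst f (reduce w) \<approx> subst f w"
proof (induction w)
  case (Cons x w)
  have "subst f (reduce (x # w)) \<approx> subst f ([x] @ reduce w)"
    using subst_cancel_feq by (simp add: reduce_Cons)
  also have "\<dots> \<approx> subst f ([x] @ w)"
    unfolding subst_append using Cons by (intro feq_append) auto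
  finally show ?case by simp
qed simp

lemma subst_feq: "u \<approx> v \<Longrightarrow> subst f u \<approx> subst f v"
  by (metis feq_def subst_reduce_feq)

lemma ext_feq: "u \<approx> v \<Longrightarrow> ext f u = ext f v"
  using subst_feq[of u v f] by (simp add: ext_eq feq_def)

lemma ext_reduce [simp]: "ext f (reduce w) = ext f w"
  by (rule ext_feq) simp

lemma subst_subst_feq: "subst f (subst g w) \<approx> subst (\<lambda>i. ext f (g i)) w"
proof (induction w)
  case (Cons x w)
  have "subst f (g (fst x)) \<approx> ext f (g (fst x))" by (simp add: ext_eq)
  then show ?case using Cons
    by (auto simp: subst_Cons subst_append subst_inv_word intro!: feq_append inv_word_feq)
qed simp

lemma ext_ext: "ext f (ext g w) = ext (\<lambda>i. ext f (g i)) w"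
  using subst_subst_feq[of f g w] by (simp add: ext_eq[of g]) (simp add: ext_eq feq_def)

lemma subst_gen_id: "subst gen w = w"
  by (induction w) (auto simp: subst_Cons gen_def inv_word_def inv_letter_def prod_eq_iff)

lemma subst_cong: "(\<And>i. i \<in> fst ` set w \<Longrightarrow> f i = g i) \<Longrightarrow> subst f w = subst g w"
  unfolding subst_def by (intro arg_cong[where f = concat] map_cong) auto

section \<open>Words in the given generators and conjugacy classes\<close>

definition over :: "nat \<Rightarrow> word \<Rightarrow> bool" where
  "over n w \<longleftrightarrow> fst ` set w \<subseteq> {1..n}"

lemma carrier_iff: "w \<in> carrier n \<longleftrightarrow> reduced w \<and> over n w"
  by (auto simp: carrier_def over_def)

lemma over_simps [simp]:
  "over n []" "over n (x # w) \<longleftrightarrow> fst x \<in> {1..n} \<and> over n w"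
  "over n (u @ v) \<longleftrightarrow> over n u \<and> over n v" "over n (inv_word w) \<longleftrightarrow> over n w"
  by (simp_all add: over_def set_inv_word image_image image_Un)

lemma over_reduce: "over n w \<Longrightarrow> over n (reduce w)"
  using set_reduce_subset[of w] by (auto simp: over_def)

lemma reduce_in_carrier: "over n w \<Longrightarrow> reduce w \<in> carrier n"
  by (simp add: carrier_iff over_reduce)

lemma over_subst: "(\<And>i. i \<in> {1..n} \<Longrightarrow> over n (f i)) \<Longrightarrow> over n w \<Longrightarrow> over n (subst f w)"
  by (induction w) (auto simp: subst_Cons)

lemma reduce_carrier: "w \<in> carrier n \<Longrightarrow> reduce w = w"
  by (simp add: carrier_iff reduce_reduced)

lemma conjugate_iff: "conjugate n u v \<longleftrightarrow> (\<exists>h. over n h \<and> v = reduce (h @ u @ inv_word h))"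
proof
  assume "conjugate n u v"
  then obtain g where g: "g \<in> carrier n" "v = reduce (reduce (g @ u) @ inv_word g)"
    by (auto simp: conjugate_def mult_def)
  have "reduce (g @ u) @ inv_word g \<approx> (g @ u) @ inv_word g" by (intro feq_append) auto
  then show "\<exists>h. over n h \<and> v = reduce (h @ u @ inv_word h)"
    using g by (auto simp: carrier_iff feq_def)
next
  assume "\<exists>h. over n h \<and> v = reduce (h @ u @ inv_word h)"
  then obtain h where h: "over n h" "v = reduce (h @ u @ inv_word h)" by auto
  have "reduce (reduce h @ u) @ inv_word (reduce h) \<approx> (h @ u) @ inv_word h"
  proof (intro feq_append inv_word_feq)
    have "reduce (reduce h @ u) \<approx> reduce h @ u" by simp
    also have "\<dots> \<approx> h @ u" by (intro feq_append) auto
    finally show "reduce (reduce h @ u) \<approx> h @ u" .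
  qed auto
  then show "conjugate n u v" unfolding conjugate_def mult_def
    using h by (intro bexI[of _ "reduce h"]) (auto simp: feq_def reduce_in_carrier)
qed

lemma conj_class_eqI:
  assumes "v = reduce (h @ u @ inv_word h)" "over n h"
  shows "conj_class n u = conj_class n v"
proof (intro set_eqI iffI)
  fix x assume "x \<in> conj_class n u"
  then obtain k where k: "x \<in> carrier n" "over n k" "x = reduce (k @ u @ inv_word k)"
    by (auto simp: conj_class_def conjugate_iff)
  have "(k @ inv_word h) @ v @ inv_word (k @ inv_word h)
      \<approx> (k @ inv_word h) @ (h @ u @ inv_word h) @ inv_word (k @ inv_word h)"
    unfolding assms by (intro feq_append) auto
  also have "\<dots> = k @ (inv_word h @ h @ u @ inv_word h @ h) @ inv_word k"
    by (simp add: inv_word_append)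
  also have "\<dots> \<approx> k @ (u @ inv_word h @ h) @ inv_word k"
    by (rule feq_append[OF feq_refl feq_append[OF inv_word_cancel_feq(1) feq_refl]])
  also have "\<dots> = k @ u @ (inv_word h @ h @ inv_word k)"
    by simp
  also have "\<dots> \<approx> k @ u @ inv_word k"
    by (rule feq_append[OF feq_refl feq_append[OF feq_refl inv_word_cancel_feq(1)]])
  finally show "x \<in> conj_class n v" using k assms(2)
    by (auto simp: conj_class_def conjugate_iff feq_def intro!: exI[of _ "k @ inv_word h"])
next
  fix x assume "x \<in> conj_class n v"
  then obtain k where k: "x \<in> carrier n" "over n k" "x = reduce (k @ v @ inv_word k)"
    by (auto simp: conj_class_def conjugate_iff)
  have "k @ v @ inv_word k \<approx> k @ (h @ u @ inv_word h) @ inv_word k"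
    unfolding assms by (intro feq_append) auto
  also have "\<dots> = (k @ h) @ u @ inv_word (k @ h)" by (simp add: inv_word_append)
  finally show "x \<in> conj_class n u" using k assms(2)
    by (auto simp: conj_class_def conjugate_iff feq_def intro!: exI[of _ "k @ h"])
qed

text \<open>Each generator is only asked to go to a conjugate of some generator, which passes to
  composites directly; that every class is reached comes from the inverse map in a
  \<open>braid_pair\<close>. Fixing \<open>tprod n\<close> amounts to fixing its inverse
  \<open>z1 n\<close>.\<close>

definition braid_map :: "nat \<Rightarrow> (nat \<Rightarrow> word) \<Rightarrow> bool" where
  "braid_map n f \<longleftrightarrow>
     (\<forall>i\<in>{1..n}. over n (f i) \<and> reduced (f i)
        \<and> (\<exists>j\<in>{1..n}. \<exists>h. over n h \<and> f i \<approx> h @ gen j @ inv_word h))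
     \<and> ext f (tprod n) = tprod n"

text \<open>Carrying the inverse along makes membership in the group \<open>B\<^sub>n\<close> closed under inversion by symmetry.\<close>

definition braid_pair :: "nat \<Rightarrow> (nat \<Rightarrow> word) \<Rightarrow> (nat \<Rightarrow> word) \<Rightarrow> bool" where
  "braid_pair n f g \<longleftrightarrow> braid_map n f \<and> braid_map n g
     \<and> (\<forall>i\<in>{1..n}. subst f (g i) \<approx> gen i \<and> subst g (f i) \<approx> gen i)"

lemma braid_pair_sym: "braid_pair n f g \<Longrightarrow> braid_pair n g f"
  by (auto simp: braid_pair_def)

lemma subst_inverse_feq:
  assumes "\<And>i. i \<in> {1..n} \<Longrightarrow> subst f (g i) \<approx> gen i" "over n w"
  shows "subst f (subst g w) \<approx> w"
proof -
  have "subst (\<lambda>i. ext f (g i)) w = subst gen w"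
  proof (rule subst_cong)
    fix i assume "i \<in> fst ` set w"
    then have "i \<in> {1..n}" using assms(2) by (auto simp: over_def)
    then have "subst f (g i) \<approx> gen i" using assms(1) by auto
    then show "ext f (g i) = gen i"
      by (simp add: ext_eq feq_def gen_def reduce_Cons)
  qed
  then show ?thesis using subst_subst_feq[of f g w] by (simp add: subst_gen_id)
qed

lemma braid_pair_ext_ext:
  assumes "braid_pair n f g" "w \<in> carrier n"
  shows "ext f (ext g w) = w"
proof -
  have "ext f (ext g w) = ext f (subst g w)" by (simp add: ext_eq[of g])
  also have "\<dots> = reduce w"
    using subst_inverse_feq[of n f g w] assms
    by (auto simp: braid_pair_def ext_eq feq_def carrier_iff)
  finally show ?thesis using assms(2) by (simp add: reduce_carrier)
qed

section \<open>Membership in \<open>Bn n\<close> and composition\<close>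

lemma reduced_append:
  "reduced (u @ v) \<longleftrightarrow> reduced u \<and> reduced v \<and> (u = [] \<or> v = [] \<or> hd v \<noteq> inv_letter (last u))"
  by (induction u) (auto simp: reduced_Cons)

lemma reduced_inv_word: "reduced w \<Longrightarrow> reduced (inv_word w)"
proof (induction w)
  case (Cons x w)
  then show ?case
    by (cases w) (auto simp: inv_word_Cons reduced_append)
qed simp

lemma reduced_positive: "\<forall>x\<in>set w. \<not> snd x \<Longrightarrow> reduced w"
  by (induction w rule: reduced.induct) (auto simp: inv_letter_def)

lemma tprod_carrier: "k \<le> n \<Longrightarrow> tprod k \<in> carrier n"
  by (auto simp: carrier_iff tprod_def over_def intro!: reduced_positive)

lemma ext_carrier:
  assumes "braid_map n f" "w \<in> carrier n"
  shows "ext f w \<in> carrier n"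
  unfolding ext_eq using assms
  by (intro reduce_in_carrier over_subst) (auto simp: braid_map_def carrier_iff)

lemma ext_z1:
  assumes "ext f (tprod n) = tprod n"
  shows "ext f (z1 n) = z1 n"
proof -
  have "subst f (inv_word (tprod n)) \<approx> inv_word (tprod n)"
    unfolding subst_inv_word
  proof (rule inv_word_feq)
    show "subst f (tprod n) \<approx> tprod n"
      using assms by (metis ext_eq feq_reduce(2))
  qed
  moreover have "reduced (inv_word (tprod n))"
    using tprod_carrier[of n n] by (auto intro: reduced_inv_word simp: carrier_iff)
  ultimately show ?thesis by (simp add: ext_eq z1_def feq_def reduce_reduced)
qed

lemma braid_pair_imp_Bn:
  assumes "braid_pair n f g"
  shows "f \<in> Bn n"
proof -
  have f: "braid_map n f" and g: "braid_map n g"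
    using assms by (auto simp: braid_pair_def)
  have "bij_betw (ext f) (carrier n) (carrier n)"
    by (rule bij_betw_byWitness[where f' = "ext g"])
      (use assms f g braid_pair_sym in \<open>auto intro!: braid_pair_ext_ext ext_carrier\<close>)
  moreover have "(\<lambda>i. conj_class n (ext f (gen i))) ` {1..n} = (\<lambda>i. conj_class n (gen i)) ` {1..n}"
  proof (intro equalityI image_subsetI)
    fix i assume "i \<in> {1..n}"
    then obtain j h where "j \<in> {1..n}" "over n h" "f i \<approx> h @ gen j @ inv_word h"
      using f unfolding braid_map_def by blast
    then show "conj_class n (ext f (gen i)) \<in> (\<lambda>i. conj_class n (gen i)) ` {1..n}"
      using conj_class_eqI[of "ext f (gen i)" h "gen j" n]
      by (auto simp: ext_eq subst_gen feq_def)
  next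
    \<comment> \<open>To reach the class of \<open>gen i\<close>, apply \<open>f\<close> to
      \<open>g i\<close>, a conjugate of some \<open>gen j\<close>: the result is
      \<open>gen i\<close>, now exhibited as a conjugate of \<open>f j\<close>.\<close>
    fix i assume i: "i \<in> {1..n}"
    then obtain j h where jh: "j \<in> {1..n}" "over n h" "g i \<approx> h @ gen j @ inv_word h"
      using g unfolding braid_map_def by blast
    have "gen i \<approx> subst f (g i)"
      using assms i by (auto simp: braid_pair_def intro: feq_sym)
    also have "\<dots> \<approx> subst f h @ f j @ inv_word (subst f h)"
      using subst_feq[OF jh(3), of f] by (simp add: subst_append subst_gen subst_inv_word)
    also have "\<dots> \<approx> subst f h @ ext f (gen j) @ inv_word (subst f h)"
      by (intro feq_append) (auto simp: ext_eq subst_gen)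
    finally have "gen i = reduce (subst f h @ ext f (gen j) @ inv_word (subst f h))"
      by (simp add: feq_def gen_def reduce_Cons)
    moreover have "over n (subst f h)"
      using f jh by (intro over_subst) (auto simp: braid_map_def)
    ultimately have "conj_class n (ext f (gen j)) = conj_class n (gen i)"
      by (rule conj_class_eqI)
    then show "conj_class n (gen i) \<in> (\<lambda>i. conj_class n (ext f (gen i))) ` {1..n}"
      using jh(1) by force
  qed
  moreover have "ext f (z1 n) = z1 n" using f by (auto intro: ext_z1 simp: braid_map_def)
  ultimately show ?thesis using f by (auto simp: Bn_def braid_map_def carrier_iff)
qed

lemma braid_map_comp:
  assumes "braid_map n f" "braid_map n g"
  shows "braid_map n (\<lambda>i. ext f (g i))"
proof -
  have "over n (ext f (g i)) \<and> reduced (ext f (g i))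
      \<and> (\<exists>j\<in>{1..n}. \<exists>h. over n h \<and> ext f (g i) \<approx> h @ gen j @ inv_word h)" if i: "i \<in> {1..n}" for i
  proof -
    obtain j h where jh: "j \<in> {1..n}" "over n h" "g i \<approx> h @ gen j @ inv_word h"
      using i assms(2) unfolding braid_map_def by blast
    obtain k h' where kh: "k \<in> {1..n}" "over n h'" "f j \<approx> h' @ gen k @ inv_word h'"
      using jh(1) assms(1) unfolding braid_map_def by blast
    have "ext f (g i) \<approx> subst f (h @ gen j @ inv_word h)"
      using ext_feq[OF jh(3), of f] by (simp add: ext_eq feq_def reduce_reduced)
    also have "\<dots> = subst f h @ f j @ inv_word (subst f h)"
      by (simp add: subst_append subst_gen subst_inv_word)
    also have "\<dots> \<approx> subst f h @ (h' @ gen k @ inv_word h') @ inv_word (subst f h)"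
      using kh by (intro feq_append) auto
    also have "\<dots> = (subst f h @ h') @ gen k @ inv_word (subst f h @ h')"
      by (simp add: inv_word_append)
    finally have "ext f (g i) \<approx> (subst f h @ h') @ gen k @ inv_word (subst f h @ h')" .
    moreover have "over n (subst f h @ h')"
      using assms(1) jh kh by (auto simp: braid_map_def intro!: over_subst)
    moreover have "ext f (g i) \<in> carrier n"
      using assms i by (intro ext_carrier) (auto simp: braid_map_def carrier_iff)
    ultimately show ?thesis using kh(1) unfolding carrier_iff by blast
  qed
  moreover have "ext (\<lambda>i. ext f (g i)) (tprod n) = tprod n"
    using assms by (simp add: ext_ext[symmetric] braid_map_def)
  ultimately show ?thesis by (simp add: braid_map_def)
qed

lemma braid_pair_comp:
  assumes "braid_pair n f g" "braid_pair n f' g'"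
  shows "braid_pair n (\<lambda>i. ext f (f' i)) (\<lambda>i. ext g' (g i))"
proof -
  have *: "subst (\<lambda>i. ext f (f' i)) (ext g' (g i)) \<approx> gen i"
    if "braid_pair n f g" "braid_pair n f' g'" "i \<in> {1..n}" for i f g f' g'
  proof -
    have "subst (\<lambda>i. ext f (f' i)) (ext g' (g i)) \<approx> ext f (ext f' (ext g' (g i)))"
      unfolding ext_ext[of f f'] by (subst (2) ext_eq) simp
    also have "ext f' (ext g' (g i)) = g i"
      using that by (intro braid_pair_ext_ext) (auto simp: braid_pair_def braid_map_def carrier_iff)
    also have "ext f (g i) \<approx> gen i"
      using that by (auto simp: ext_eq braid_pair_def feq_def reduce_reduced)
    finally show ?thesis .
  qed
  show ?thesis
    using assms *[OF assms] *[OF assms(2,1)[THEN braid_pair_sym]]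
    by (auto simp: braid_pair_def intro!: braid_map_comp)
qed

text \<open>The anti-automorphism induced by the reflection of the disc composed with reversal of loops.\<close>

definition mirror :: "nat \<Rightarrow> word \<Rightarrow> word" where
  "mirror n w = rev (map (\<lambda>x. (Suc n - fst x, snd x)) w)"

lemma mirror_simps [simp]:
  "mirror n [] = []" "mirror n (x # w) = mirror n w @ [(Suc n - fst x, snd x)]"
  "mirror n (u @ v) = mirror n v @ mirror n u"
  by (simp_all add: mirror_def)

lemma mirror_inv_word: "mirror n (inv_word w) = inv_word (mirror n w)"
  by (induction w) (simp_all add: inv_word_Cons inv_word_append inv_letter_def)

lemma over_mirror [simp]: "over n w \<Longrightarrow> over n (mirror n w)"
  by (induction w) auto

lemma mirror_mirror: "over n w \<Longrightarrow> mirror n (mirror n w) = w"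
  by (induction w) auto

lemma mirror_reduce_feq: "mirror n (reduce w) \<approx> mirror n w"
proof (induction w)
  case (Cons x w)
  have "mirror n (cancel x u) \<approx> mirror n (x # u)" for u
  proof (cases u)
    case u: (Cons y ys)
    let ?x = "(Suc n - fst x, snd x)"
    have "mirror n ys @ [inv_letter ?x, ?x] \<approx> mirror n ys @ []"
      using feq_cancel_pair'[of ?x "[]"] by (intro feq_append) auto
    then show ?thesis by (auto simp: u inv_letter_def intro: feq_sym)
  qed simp
  from this[of "reduce w"] have "mirror n (reduce (x # w)) \<approx> mirror n (reduce w) @ mirror n [x]"
    by (simp add: reduce_Cons)
  also have "\<dots> \<approx> mirror n w @ mirror n [x]" using Cons by (intro feq_append) auto
  finally show ?case by simp
qed simp

lemma mirror_feq: "u \<approx> v \<Longrightarrow> mirror n u \<approx> mirror n v"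
  by (metis feq_def mirror_reduce_feq)

lemma reduced_mirror:
  assumes "reduced w" "over n w"
  shows "reduced (mirror n w)"
  using assms
proof (induction w)
  case (Cons x w)
  show ?case
  proof (cases w)
    case (Cons y ys)
    then show ?thesis using Cons.prems Cons.IH
      by (auto simp: reduced_append inv_letter_def prod_eq_iff)
  qed simp
qed simp

lemma reduce_mirror: "over n w \<Longrightarrow> reduce (mirror n w) = mirror n (reduce w)"
  using mirror_reduce_feq[of n w]
  by (simp add: feq_def reduce_reduced reduced_mirror over_reduce)

text \<open>\<open>mirror n\<close> reverses products, so conjugating by it reverses them twice and
  gives an automorphism again. In this way a braid that acts on the reflected disc is transported
  back.\<close>

definition mirror_map :: "nat \<Rightarrow> (nat \<Rightarrow> word) \<Rightarrow> nat \<Rightarrow> word" where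
  "mirror_map n f i = mirror n (f (Suc n - i))"

lemma subst_mirror_map: "subst (mirror_map n f) w = mirror n (subst f (mirror n w))"
  by (induction w) (auto simp: subst_Cons subst_append mirror_map_def mirror_inv_word)

lemma mirror_gen: "mirror n (gen j) = gen (Suc n - j)"
  by (simp add: gen_def)

lemma mirror_tprod: "mirror n (tprod n) = tprod n"
  by (rule nth_equalityI) (auto simp: mirror_def tprod_def rev_nth simp del: upt_Suc)

lemma ext_mirror_map:
  assumes "\<And>i. i \<in> {1..n} \<Longrightarrow> over n (f i)" "over n w"
  shows "ext (mirror_map n f) w = mirror n (ext f (mirror n w))"
  using over_subst[of n f "mirror n w"] assms
  by (simp add: ext_eq subst_mirror_map reduce_mirror)

lemma braid_map_mirror_map:
  assumes "braid_map n f"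
  shows "braid_map n (mirror_map n f)"
proof -
  have "\<exists>j\<in>{1..n}. \<exists>h. over n h \<and> mirror_map n f i \<approx> h @ gen j @ inv_word h" if i: "i \<in> {1..n}" for i
  proof -
    have "Suc n - i \<in> {1..n}" using i by auto
    then obtain j h where jh: "j \<in> {1..n}" "over n h" "f (Suc n - i) \<approx> h @ gen j @ inv_word h"
      using assms unfolding braid_map_def by blast
    have "mirror_map n f i \<approx> mirror n (h @ gen j @ inv_word h)"
      unfolding mirror_map_def using jh(3) by (rule mirror_feq)
    also have "\<dots> = inv_word (mirror n h) @ gen (Suc n - j) @ inv_word (inv_word (mirror n h))"
      by (simp add: mirror_gen mirror_inv_word)
    finally show ?thesis using jh
      by (intro bexI[of _ "Suc n - j"] exI[of _ "inv_word (mirror n h)"]) auto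
  qed
  moreover have "over n (mirror_map n f i) \<and> reduced (mirror_map n f i)" if "i \<in> {1..n}" for i
  proof -
    have "Suc n - i \<in> {1..n}" using that by auto
    then have "over n (f (Suc n - i))" "reduced (f (Suc n - i))"
      using assms unfolding braid_map_def by blast+
    then show ?thesis by (simp add: mirror_map_def reduced_mirror)
  qed
  moreover have "ext (mirror_map n f) (tprod n) = tprod n"
  proof -
    have "over n (tprod n)" using tprod_carrier[of n n] by (simp add: carrier_iff)
    then show ?thesis using assms
      by (subst ext_mirror_map) (auto simp: mirror_tprod braid_map_def)
  qed
  ultimately show ?thesis by (simp add: braid_map_def)
qed

lemma braid_pair_mirror_map:
  assumes "braid_pair n f g"
  shows "braid_pair n (mirror_map n f) (mirror_map n g)"
proof -
  have *: "subst (mirror_map n f) (mirror_map n g i) \<approx> gen i"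
    if "braid_pair n f g" "i \<in> {1..n}" for f g i
  proof -
    have i: "Suc n - i \<in> {1..n}" using that by auto
    then have "over n (g (Suc n - i))" "subst f (g (Suc n - i)) \<approx> gen (Suc n - i)"
      using that unfolding braid_pair_def braid_map_def by blast+
    then show ?thesis
      using mirror_feq[of "subst f (g (Suc n - i))" "gen (Suc n - i)" n] that(2)
      by (simp add: subst_mirror_map mirror_mirror mirror_map_def mirror_gen)
  qed
  show ?thesis using assms *[OF assms] *[OF braid_pair_sym[OF assms]]
    by (auto simp: braid_pair_def intro: braid_map_mirror_map)
qed

text \<open>For \<open>j = i + 1\<close> this is an Artin generator of the braid group; in general
  it is a product of \<open>j - i\<close> of them, which carries the j-th puncture past its
  neighbours down to \<open>i\<close>.\<close>

definition left_move :: "nat \<Rightarrow> nat \<Rightarrow> nat \<Rightarrow> word" where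
  "left_move i j l = (if i \<le> l \<and> l < j then [(i, False), (Suc l, False), (i, True)]
     else if l = j then gen i else gen l)"

definition right_move :: "nat \<Rightarrow> nat \<Rightarrow> nat \<Rightarrow> word" where
  "right_move i j l = (if i < l \<and> l \<le> j then [(j, True), (l - 1, False), (j, False)]
     else if l = i then gen j else gen l)"

lemma tprod_split:
  assumes "1 \<le> i" "i \<le> j" "j \<le> n"
  shows "tprod n = tprod (i - 1) @ map (\<lambda>l. (l, False)) [i..<Suc j] @ map (\<lambda>l. (l, False)) [Suc j..<Suc n]"
proof -
  have "[1..<Suc n] = [1..<i] @ [i..<Suc j] @ [Suc j..<Suc n]"
    using assms upt_add_eq_append[of 1 i "Suc n - i"] upt_add_eq_append[of i "Suc j" "n - j"]
    by (simp del: upt_Suc)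
  then show ?thesis using assms by (simp add: tprod_def del: upt_Suc)
qed

lemma subst_gen_eqs: "\<forall>l\<in>set ls. f l = gen l \<Longrightarrow> subst f (map (\<lambda>l. (l, False)) ls) = map (\<lambda>l. (l, False)) ls"
  by (induction ls) (auto simp: subst_Cons gen_def)

text \<open>The conjugators telescope: each inverse of \<open>t_i\<close> meets the
  \<open>t_i\<close> that opens the next factor. The last one meets the appended \<open>t_i\<close>,
  which in the application is the image of \<open>t_j\<close>.\<close>

lemma subst_conj_list:
  assumes "\<forall>l\<in>set ls. f l = [(i, False), (Suc l, False), (i, True)]"
  shows "subst f (map (\<lambda>l. (l, False)) ls) @ [(i, False)] \<approx> (i, False) # map (\<lambda>l. (Suc l, False)) ls"
  using assms
proof (induction ls)
  case (Cons l ls)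
  let ?r = "map (\<lambda>l. (Suc l, False)) ls"
  have "subst f (map (\<lambda>l. (l, False)) (l # ls)) @ [(i, False)]
      = [(i, False), (Suc l, False), (i, True)] @ (subst f (map (\<lambda>l. (l, False)) ls) @ [(i, False)])"
    using Cons.prems by (simp add: subst_Cons)
  also have "\<dots> \<approx> [(i, False), (Suc l, False), (i, True)] @ ((i, False) # ?r)"
    using Cons by (intro feq_append) auto
  also have "\<dots> = [(i, False), (Suc l, False)] @ ((i, True) # (i, False) # ?r)"
    by simp
  also have "\<dots> \<approx> [(i, False), (Suc l, False)] @ ?r"
    using feq_cancel_pair[of "(i, True)" ?r] by (intro feq_append) auto
  finally show ?case by simp
qed simp

lemma ext_left_move_tprod:
  assumes "1 \<le> i" "i < j" "j \<le> n"
  shows "ext (left_move i j) (tprod n) = tprod n"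
proof -
  let ?f = "left_move i j" and ?m = "map (\<lambda>l. (l, False))"
  have "subst ?f (?m [i..<Suc j]) = subst ?f (?m [i..<j]) @ [(i, False)]"
    using assms by (simp add: subst_append subst_Cons left_move_def gen_def)
  also have "\<dots> \<approx> (i, False) # map (\<lambda>l. (Suc l, False)) [i..<j]"
    by (rule subst_conj_list) (simp add: left_move_def)
  also have "\<dots> = ?m (i # map Suc [i..<j])" by simp
  also have "i # map Suc [i..<j] = [i..<Suc j]"
    using assms by (simp only: map_Suc_upt) (simp add: upt_rec[of i])
  finally have "subst ?f (?m [i..<Suc j]) \<approx> ?m [i..<Suc j]" .
  moreover have "subst ?f (tprod (i - 1)) = tprod (i - 1)"
    unfolding tprod_def by (rule subst_gen_eqs) (use assms in \<open>auto simp: left_move_def\<close>)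
  moreover have "subst ?f (?m [Suc j..<Suc n]) = ?m [Suc j..<Suc n]"
    by (rule subst_gen_eqs) (use assms in \<open>auto simp: left_move_def\<close>)
  ultimately have "subst ?f (tprod n) \<approx> tprod n"
    using assms unfolding tprod_split[OF assms(1) less_imp_le[OF assms(2)] assms(3)] subst_append
    by (intro feq_append) auto
  then show ?thesis using tprod_carrier[of n n] by (simp add: ext_eq feq_def reduce_carrier)
qed

lemma left_right_move:
  assumes "1 \<le> i" "i < j"
  shows "subst (left_move i j) (right_move i j l) \<approx> gen l"
    and "subst (right_move i j) (left_move i j l) \<approx> gen l"
  using assms
  by (auto simp: left_move_def right_move_def gen_def subst_Cons feq_def reduce_def inv_word_def)

lemma braid_pair_left_move:
  assumes "1 \<le> i" "i < j" "j \<le> n"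
  shows "braid_pair n (left_move i j) (right_move i j)"
proof -
  have tp: "over n (tprod n)" using tprod_carrier[of n n] by (simp add: carrier_iff)
  have "ext (right_move i j) (tprod n) = ext (right_move i j) (ext (left_move i j) (tprod n))"
    using assms by (simp add: ext_left_move_tprod)
  also have "\<dots> = reduce (subst (right_move i j) (subst (left_move i j) (tprod n)))"
    by (simp add: ext_eq[of "left_move i j"]) (simp add: ext_eq)
  also have "\<dots> = tprod n"
    using subst_inverse_feq[of n "right_move i j" "left_move i j", OF _ tp] assms
      tprod_carrier[of n n] left_right_move(2)
    by (simp add: feq_def reduce_carrier)
  finally have tpr: "ext (right_move i j) (tprod n) = tprod n" .
  have "\<exists>k\<in>{1..n}. \<exists>h. over n h \<and> left_move i j l \<approx> h @ gen k @ inv_word h" if "l \<in> {1..n}" for l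
  proof (cases "i \<le> l \<and> l < j")
    case True
    then show ?thesis using assms
      by (intro bexI[of _ "Suc l"] exI[of _ "gen i"]) (auto simp: left_move_def gen_def inv_word_def)
  next
    case False
    then show ?thesis using assms that
      by (intro bexI[of _ "if l = j then i else l"] exI[of _ "[]"]) (auto simp: left_move_def)
  qed
  moreover have "\<exists>k\<in>{1..n}. \<exists>h. over n h \<and> right_move i j l \<approx> h @ gen k @ inv_word h" if "l \<in> {1..n}" for l
  proof (cases "i < l \<and> l \<le> j")
    case True
    then show ?thesis using assms
      by (intro bexI[of _ "l - 1"] exI[of _ "inv_word (gen j)"]) (auto simp: right_move_def gen_def inv_word_def)
  next
    case False
    then show ?thesis using assms that
      by (intro bexI[of _ "if l = i then j else l"] exI[of _ "[]"]) (auto simp: right_move_def)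
  qed
  moreover have "over n (left_move i j l) \<and> reduced (left_move i j l)
      \<and> over n (right_move i j l) \<and> reduced (right_move i j l)" if "l \<in> {1..n}" for l
    using that assms by (auto simp: left_move_def right_move_def gen_def)
  ultimately show ?thesis
    using assms left_right_move tpr ext_left_move_tprod by (simp add: braid_pair_def braid_map_def)
qed

text \<open>The step of the inductions: once the simpler word \<open>ext f w\<close> is known to lie
  in the orbit of \<open>u\<close>, composing with the inverse of \<open>f\<close> brings
  \<open>w\<close> there.\<close>

lemma orbit_pull_back:
  assumes "braid_pair n f g" "w \<in> carrier n" "\<exists>f' g'. braid_pair n f' g' \<and> ext f' u = ext f w"
  shows "\<exists>f' g'. braid_pair n f' g' \<and> ext f' u = w"
proof -
  obtain f' g' where fg: "braid_pair n f' g'" "ext f' u = ext f w"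
    using assms(3) by auto
  have "braid_pair n (\<lambda>i. ext g (f' i)) (\<lambda>i. ext g' (f i))"
    using braid_pair_comp[OF braid_pair_sym[OF assms(1)] fg(1)] .
  moreover have "ext (\<lambda>i. ext g (f' i)) u = w"
    using braid_pair_ext_ext[OF braid_pair_sym[OF assms(1)] assms(2)] fg(2)
    by (simp add: ext_ext[symmetric])
  ultimately show ?thesis by blast
qed

section \<open>The exponent sum as an orbit invariant\<close>

definition exp_sum :: "word \<Rightarrow> int" where
  "exp_sum w = (\<Sum>x\<leftarrow>w. if snd x then -1 else 1)"

lemma exp_sum_simps [simp]: "exp_sum [] = 0"
  "exp_sum (x # w) = (if snd x then -1 else 1) + exp_sum w"
  "exp_sum (u @ v) = exp_sum u + exp_sum v"
  by (simp_all add: exp_sum_def)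

lemma exp_sum_inv_word [simp]: "exp_sum (inv_word w) = - exp_sum w"
  by (induction w) (auto simp: inv_word_Cons inv_letter_def)

lemma exp_sum_reduce [simp]: "exp_sum (reduce w) = exp_sum w"
proof (induction w)
  case (Cons x w)
  have "exp_sum (cancel x u) = exp_sum (x # u)" for u
    by (cases u) (auto simp: inv_letter_def)
  then show ?case using Cons by (simp add: reduce_Cons)
qed simp

text \<open>Exponent sums are invariant under conjugation and equal 1 on generators, so it suffices
  that \<open>f i\<close> lies in the class of some \<open>gen j\<close>.\<close>

lemma exp_sum_Bn:
  assumes "f \<in> Bn n" "i \<in> {1..n}"
  shows "exp_sum (f i) = 1"
proof -
  have fi: "f i \<in> carrier n" using assms by (auto simp: Bn_def)
  then have e: "ext f (gen i) = f i" by (simp add: ext_eq subst_gen reduce_carrier)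
  have "conj_class n (ext f (gen i)) \<in> (\<lambda>i. conj_class n (gen i)) ` {1..n}"
  proof -
    have "conj_class n (ext f (gen i)) \<in> (\<lambda>i. conj_class n (ext f (gen i))) ` {1..n}"
      using assms(2) by (rule imageI)
    then show ?thesis using assms(1) by (simp add: Bn_def)
  qed
  then obtain j where j: "conj_class n (f i) = conj_class n (gen j)" using e by auto
  \<comment> \<open>Conjugation by the empty word puts \<open>f i\<close> into its own class, which
    is that of \<open>gen j\<close>.\<close>
  have "f i \<in> conj_class n (f i)"
    using fi by (auto simp: conj_class_def conjugate_iff reduce_carrier intro!: exI[of _ "[]"])
  then obtain h where "f i = reduce (h @ gen j @ inv_word h)"
    unfolding j by (auto simp: conj_class_def conjugate_iff)
  then show ?thesis by (simp add: gen_def)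
qed

lemma exp_sum_ext:
  assumes "f \<in> Bn n" "over n w"
  shows "exp_sum (ext f w) = exp_sum w"
proof -
  have "exp_sum (subst f w) = exp_sum w"
    using assms(2) exp_sum_Bn[OF assms(1)] by (induction w) (auto simp: subst_Cons)
  then show ?thesis by (simp add: ext_eq)
qed

lemma exp_sum_tprod: "exp_sum (tprod k) = int k"
  by (induction k) (simp_all add: tprod_def)

lemma orbit_tprod_unique:
  assumes "w \<in> orbit n (tprod k)" "w \<in> orbit n (tprod k')" "k \<le> n" "k' \<le> n"
  shows "k = k'"
proof -
  have *: "exp_sum w = int l" if "w \<in> orbit n (tprod l)" "l \<le> n" for l
    using that exp_sum_ext[of _ n "tprod l"] tprod_carrier[of l n]
    by (auto simp: orbit_def carrier_iff exp_sum_tprod)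
  show ?thesis using *[of k] *[of k'] assms by simp
qed

section \<open>Simple arcs\<close>

text \<open>
  The ray \<open>r\<^sub>l\<close> is crossed at heights \<open>h > 0\<close> (distance from the puncture); \<open>(l, -h)\<close> and \<open>(l, h)\<close> are
  the copies of such a crossing on the left and right side of \<open>r\<^sub>l\<close>, so the lexicographic order is
  the order along the boundary of the polygon. A curve is the list of the points at which it arrives at
  the rays; \<open>(l, -h)\<close> stands for \<open>t\<^sub>l\<close> and \<open>(l, h)\<close> for its inverse. The base point appears as
  \<open>(0, 1)\<close> at the start and as \<open>(n + 1, -1)\<close> at the end.
\<close>

type_synonym point = "nat \<times> int"

definition flip :: "point \<Rightarrow> point" where
  "flip p = (fst p, - snd p)"

definition btw :: "'a::linorder \<Rightarrow> 'a \<Rightarrow> 'a \<Rightarrow> bool" where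
  "btw a b x \<longleftrightarrow> min a b < x \<and> x < max a b"

text \<open>For ends on a line, chords drawn on one side of it can be made disjoint when both or
  neither of the ends of one lie between those of the other. Comparing a chord with itself is
  harmless because \<open>btw\<close> is strict.\<close>

definition noncrossing :: "('a::linorder \<times> 'a) set \<Rightarrow> bool" where
  "noncrossing A \<longleftrightarrow> (\<forall>a\<in>A. \<forall>b\<in>A. btw (fst a) (snd a) (fst b) \<longleftrightarrow> btw (fst a) (snd a) (snd b))"

fun arcs :: "point \<Rightarrow> point list \<Rightarrow> point \<Rightarrow> (point \<times> point) list" where
  "arcs P [] E = [(P, E)]"
| "arcs P (x # c) E = (P, x) # arcs (flip x) c E"

abbreviation curve_arcs :: "nat \<Rightarrow> point list \<Rightarrow> (point \<times> point) list" where
  "curve_arcs n c \<equiv> arcs (0, 1) c (Suc n, -1)"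

text \<open>Absolute values identify the two sides of a crossing, so distinctness forbids meeting a
  point of a ray twice, in either direction.\<close>

definition curve :: "nat \<Rightarrow> point list \<Rightarrow> bool" where
  "curve n c \<longleftrightarrow> (\<forall>p\<in>set c. fst p \<in> {1..n} \<and> snd p \<noteq> 0)
     \<and> distinct (map (\<lambda>p. (fst p, \<bar>snd p\<bar>)) c)
     \<and> noncrossing (set (curve_arcs n c))"

definition word_of :: "point list \<Rightarrow> word" where
  "word_of c = map (\<lambda>p. (fst p, snd p > 0)) c"

lemma flip_flip [simp]: "flip (flip p) = p"
  by (simp add: flip_def)

lemma fst_flip [simp]: "fst (flip p) = fst p" and snd_flip [simp]: "snd (flip p) = - snd p"
  by (simp_all add: flip_def)

lemma flip_Pair [simp]: "flip (l, e) = (l, - e)"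
  by (simp add: flip_def)

lemma flip_eq_iff [simp]: "flip p = flip q \<longleftrightarrow> p = q"
  by (metis flip_flip)

lemma arcs_eq_zip: "arcs P c E = zip (P # map flip c) (c @ [E])"
  by (induction c arbitrary: P) simp_all

lemma length_arcs [simp]: "length (arcs P c E) = Suc (length c)"
  by (simp add: arcs_eq_zip)

lemma nth_arcs: "k \<le> length c \<Longrightarrow> arcs P c E ! k = ((P # map flip c) ! k, (c @ [E]) ! k)"
  by (simp add: arcs_eq_zip)

section \<open>From planar words to curves\<close>

lemma nth_whitehead:
  assumes "k < length w"
  shows "whitehead n w ! (2 * k + 1) = code (w ! k)"
    and "whitehead n w ! (2 * k + 2) = code (inv_letter (w ! k))"
proof -
  have *: "concat (map (\<lambda>a. [code a, code (inv_letter a)]) w) ! (2 * k) = code (w ! k)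
      \<and> concat (map (\<lambda>a. [code a, code (inv_letter a)]) w) ! (2 * k + 1) = code (inv_letter (w ! k))"
    using assms
  proof (induction w arbitrary: k)
    case (Cons x w)
    then show ?case by (cases k) auto
  qed simp
  have len: "length (concat (map (\<lambda>a. [code a, code (inv_letter a)]) w)) = 2 * length w"
    by (induction w) auto
  show "whitehead n w ! (2 * k + 1) = code (w ! k)" "whitehead n w ! (2 * k + 2) = code (inv_letter (w ! k))"
    using * len assms by (auto simp: whitehead_def nth_append)
qed

lemma length_whitehead: "length (whitehead n w) = 2 * length w + 2"
  by (induction w) (auto simp: whitehead_def)

lemma nth_whitehead_ends:
  "whitehead n w ! 0 = 0" "whitehead n w ! (2 * length w + 1) = 2 * n + 1"
  using length_whitehead[of n w] by (simp_all add: whitehead_def nth_append)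

lemma btw_commute: "btw a b x = btw b a x"
  by (auto simp: btw_def min_def max_def)

lemma not_btw_self [simp]: "\<not> btw a b a" "\<not> btw a b b"
  by (auto simp: btw_def min_def max_def)

lemma between_eq_btw: "between a b x = btw a b x"
  by (simp add: between_def btw_def)

text \<open>The distance between the two positions of a crossing in the given permutation serves as its height.\<close>

lemma planar_word_imp_curve:
  assumes "planar_word n w" "over n w"
  obtains c where "curve n c" "word_of c = w"
proof -
  define m where "m = length w"
  define c where "c i = whitehead n w ! (i - 1)" for i
  \<comment> \<open>Positions are counted from 1, so a letter and its inverse occupy an even
    position and the next odd one; \<open>prt\<close> exchanges these two sides of a
    crossing.\<close>
  define prt where "prt a = (if even a then a + 1 else a - 1)" for a :: nat
  let ?I = "{1..2 * m + 2}" and ?J = "{2..2 * m + 1}"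
  obtain \<pi> where bij: "bij_betw \<pi> ?I ?I"
    and mono: "\<And>i j. i \<in> ?I \<Longrightarrow> j \<in> ?I \<Longrightarrow> \<pi> i < \<pi> j \<Longrightarrow> c i \<le> c j"
    and nest1: "\<And>i j. i \<in> {1..m + 1} \<Longrightarrow> j \<in> {1..m + 1} \<Longrightarrow> i \<noteq> j \<Longrightarrow>
       nested (\<pi> (2*i-1)) (\<pi> (2*i)) (\<pi> (2*j-1)) (\<pi> (2*j))"
    and nest2: "\<And>i j. i \<in> {1..m} \<Longrightarrow> j \<in> {1..m} \<Longrightarrow> i \<noteq> j \<Longrightarrow>
       nested (\<pi> (2*i)) (\<pi> (2*i+1)) (\<pi> (2*j)) (\<pi> (2*j+1))"
    using assms(1) unfolding planar_word_def planar_tuple_def Let_def length_whitehead m_def c_def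
    by auto
  have inj: "\<pi> a = \<pi> b \<longleftrightarrow> a = b" if "a \<in> ?I" "b \<in> ?I" for a b
    using bij that by (auto simp: bij_betw_def inj_on_def)
  have prt_J: "prt a \<in> ?J" "prt (prt a) = a" "prt a \<noteq> a" if "a \<in> ?J" for a
  proof -
    show "prt a \<in> ?J"
      using that unfolding prt_def atLeastAtMost_iff by presburger
    show "prt (prt a) = a" "prt a \<noteq> a"
      using that by (auto simp: prt_def)
  qed
  define idx where "idx a = fst (w ! ((a - 2) div 2))" for a
  have c_J: "(c a = 2 * idx a - 1 \<and> c (prt a) = 2 * idx a \<or> c a = 2 * idx a \<and> c (prt a) = 2 * idx a - 1)
      \<and> idx a \<in> {1..n} \<and> idx (prt a) = idx a" if "a \<in> ?J" for a
  proof -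
    define k where "k = (a - 2) div 2"
    have k: "k < m" "a = 2 * k + 2 \<or> a = 2 * k + 3" using that by (auto simp: k_def)
    have "fst (w ! k) \<in> {1..n}"
      using assms(2) k(1) nth_mem[of k w] unfolding over_def m_def by blast
    moreover have "c (2 * k + 2) = code (w ! k)" "c (2 * k + 3) = code (inv_letter (w ! k))"
      using nth_whitehead[of k w n] k(1) by (simp_all add: c_def m_def)
    ultimately show ?thesis using k
      by (auto simp: idx_def prt_def code_def inv_letter_def numeral_3_eq_3)
  qed
  have c_ends: "c 1 = 0" "c (2 * m + 2) = 2 * n + 1"
    using nth_whitehead_ends[of n w] by (simp_all add: c_def m_def)
  have nestJ: "btw (\<pi> a) (\<pi> (prt a)) (\<pi> b) = btw (\<pi> a) (\<pi> (prt a)) (\<pi> (prt b))"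
    if "a \<in> ?J" "b \<in> ?J" "b \<noteq> a" "b \<noteq> prt a" for a b
  proof -
    have "a div 2 \<in> {1..m}" "b div 2 \<in> {1..m}" "a div 2 \<noteq> b div 2"
      using that by (auto simp: prt_def elim!: evenE oddE split: if_splits)
    from nest2[OF this] show ?thesis
      unfolding nested_def between_eq_btw prt_def
      by (cases "even a"; cases "even b") (auto simp: btw_commute elim!: evenE oddE)
  qed
  define \<Phi> :: "nat \<Rightarrow> point" where
    "\<Phi> a = (if a = 1 then (0, 1) else if a = 2 * m + 2 then (Suc n, -1)
       else (idx a, int (\<pi> a) - int (\<pi> (prt a))))" for a
  have less_c: "\<pi> a < \<pi> b" if "c a < c b" "a \<in> ?I" "b \<in> ?I" for a b
    using mono[of b a] inj[of a b] that by (cases "\<pi> a" "\<pi> b" rule: linorder_cases) auto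
  \<comment> \<open>In the alphabet \<open>t_l\<close> comes before its inverse, so the order
    condition makes the difference of positions negative exactly at the symbol \<open>t_l\<close>.
    This yields the sign convention for the two sides of a ray.\<close>
  have sgn: "snd (\<Phi> a) \<noteq> 0 \<and> c a = 2 * fst (\<Phi> a) - (if snd (\<Phi> a) < 0 then 1 else 0)" if "a \<in> ?I" for a
  proof (cases "a \<in> ?J")
    case True
    then have J: "a \<in> ?I" "prt a \<in> ?I" using prt_J[OF True] by auto
    show ?thesis using c_J[OF True] less_c[OF _ J] less_c[OF _ J(2,1)] True
      by (auto simp: \<Phi>_def)
  next
    case False
    then have "a = 1 \<or> a = 2 * m + 2" using that by auto
    then show ?thesis using c_ends by (auto simp: \<Phi>_def)
  qed
  have mono_\<Phi>: "\<Phi> a < \<Phi> b" if ab: "a \<in> ?I" "b \<in> ?I" "\<pi> a < \<pi> b" for a b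
  proof (cases "c a = c b")
    case False
    then have "c a < c b" using mono[of a b] ab by simp
    then show ?thesis using sgn[OF ab(1)] sgn[OF ab(2)]
      by (auto simp: less_prod_def split: if_splits)
  next
    case True
    have "a \<noteq> b" using ab by auto
    have J: "a \<in> ?J" "b \<in> ?J"
    proof -
      have bound: "1 \<le> c d \<and> c d \<le> 2 * n" if "d \<in> ?J" for d using c_J[OF that] by auto
      have "d \<in> ?J \<or> d = 1 \<or> d = 2 * m + 2" if "d \<in> ?I" for d using that by auto
      then have "(a \<in> ?J \<or> a = 1 \<or> a = 2 * m + 2)" "(b \<in> ?J \<or> b = 1 \<or> b = 2 * m + 2)"
        using ab by blast+
      then show "a \<in> ?J" "b \<in> ?J"
        using True \<open>a \<noteq> b\<close> c_ends bound[of a] bound[of b] by auto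
    qed
    have I: "prt a \<in> ?I" "prt b \<in> ?I" using prt_J[OF J(1)] prt_J[OF J(2)] by auto
    have idx: "idx a = idx b" "c (prt a) = c (prt b)" "c (prt a) \<noteq> c a"
      using c_J[OF J(1)] c_J[OF J(2)] True by (auto, presburger+)
    have ne: "b \<noteq> prt a" using idx True by auto
    then have ne': "a \<noteq> prt b" using prt_J[OF J(2)] by metis
    \<comment> \<open>The intervals spanned by two crossings of one ray overlap, so the second
      nesting condition puts one inside the other. On the left side the interval that begins earlier
      is the longer one; on the right side the one that ends later is.\<close>
    have "int (\<pi> a) - int (\<pi> (prt a)) < int (\<pi> b) - int (\<pi> (prt b))"
    proof (cases "c a < c (prt a)")
      case True
      then have "\<pi> b < \<pi> (prt a)" "\<pi> b < \<pi> (prt b)" "\<pi> a < \<pi> (prt a)"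
        using less_c ab I idx \<open>c a = c b\<close> by auto
      moreover from this have "btw (\<pi> a) (\<pi> (prt a)) (\<pi> b)" using ab by (simp add: btw_def)
      then have "btw (\<pi> a) (\<pi> (prt a)) (\<pi> (prt b))" using nestJ[OF J] \<open>a \<noteq> b\<close> ne by simp
      ultimately have "\<pi> (prt b) < \<pi> (prt a)" by (simp add: btw_def)
      then show ?thesis using ab by linarith
    next
      case False
      then have "\<pi> a > \<pi> (prt b)" "\<pi> b > \<pi> (prt b)" "\<pi> a > \<pi> (prt a)"
        using less_c ab I idx \<open>c a = c b\<close> by auto
      moreover from this have "btw (\<pi> b) (\<pi> (prt b)) (\<pi> a)" using ab by (simp add: btw_def)
      then have "btw (\<pi> b) (\<pi> (prt b)) (\<pi> (prt a))" using nestJ[OF J(2,1)] \<open>a \<noteq> b\<close> ne' by simp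
      ultimately have "\<pi> (prt b) < \<pi> (prt a)" by (simp add: btw_def)
      then show ?thesis using ab by linarith
    qed
    moreover have "a \<noteq> 1" "b \<noteq> 1" "a \<noteq> 2 * m + 2" "b \<noteq> 2 * m + 2" using J by auto
    ultimately show ?thesis using idx(1) by (simp add: \<Phi>_def)
  qed
  have \<Phi>_less: "\<Phi> a < \<Phi> b \<longleftrightarrow> \<pi> a < \<pi> b" if "a \<in> ?I" "b \<in> ?I" for a b
    using mono_\<Phi>[OF that] mono_\<Phi>[OF that(2,1)] inj[OF that]
    by (cases "\<pi> a" "\<pi> b" rule: linorder_cases) auto
  have \<Phi>_inj: "a = b" if "\<Phi> a = \<Phi> b" "a \<in> ?I" "b \<in> ?I" for a b
  proof -
    have "\<not> \<pi> a < \<pi> b" "\<not> \<pi> b < \<pi> a"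
      unfolding \<Phi>_less[OF that(2,3), symmetric] \<Phi>_less[OF that(3,2), symmetric] that(1) by simp_all
    then show ?thesis using inj[OF that(2,3)] by linarith
  qed
  have \<Phi>_btw: "btw (\<Phi> a) (\<Phi> b) (\<Phi> x) \<longleftrightarrow> btw (\<pi> a) (\<pi> b) (\<pi> x)"
    if "a \<in> ?I" "b \<in> ?I" "x \<in> ?I" for a b x
    using that by (simp only: btw_def min_less_iff_disj less_max_iff_disj \<Phi>_less)
  define cv where "cv = map (\<lambda>k. \<Phi> (2 * k + 2)) [0..<m]"
  have flip_\<Phi>: "flip (\<Phi> a) = \<Phi> (prt a)" if "a \<in> ?J" for a
    using that prt_J[OF that] c_J[OF that] by (auto simp: \<Phi>_def flip_def)
  have flip_\<Phi>': "flip (\<Phi> (2 * k + 2)) = \<Phi> (2 * k + 3)" if "k < m" for k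
    using flip_\<Phi>[of "2 * k + 2"] that by (simp add: prt_def numeral_3_eq_3)
  have arcs: "set (curve_arcs n cv) = (\<lambda>k. (\<Phi> (2 * k + 1), \<Phi> (2 * k + 2))) ` {..m}"
  proof -
    have nth: "curve_arcs n cv ! k = (\<Phi> (2 * k + 1), \<Phi> (2 * k + 2))" if "k \<le> m" for k
    proof -
      have "((0, 1) # map flip cv) ! k = \<Phi> (2 * k + 1)"
      proof (cases k)
        case (Suc k')
        then show ?thesis using that flip_\<Phi>'[of k'] by (simp add: cv_def numeral_3_eq_3)
      qed (simp add: \<Phi>_def)
      moreover have "(cv @ [(Suc n, -1)]) ! k = \<Phi> (2 * k + 2)"
        using that by (cases "k = m") (auto simp: cv_def nth_append \<Phi>_def)
      ultimately show ?thesis using that by (simp add: nth_arcs cv_def)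
    qed
    have "set (curve_arcs n cv) = (\<lambda>k. curve_arcs n cv ! k) ` {..<Suc m}"
      by (simp add: set_conv_nth cv_def lessThan_def image_def) blast
    also have "\<dots> = (\<lambda>k. (\<Phi> (2 * k + 1), \<Phi> (2 * k + 2))) ` {..m}"
      using nth by (intro image_cong) auto
    finally show ?thesis .
  qed
  have "noncrossing (set (curve_arcs n cv))"
    unfolding noncrossing_def arcs
  proof (clarsimp simp del: mult_Suc_right)
    fix k k' assume kk: "k \<le> m" "k' \<le> m"
    have I: "2 * k + 1 \<in> ?I" "2 * k + 2 \<in> ?I" "2 * k' + 1 \<in> ?I" "2 * k' + 2 \<in> ?I" using kk by auto
    have "btw (\<Phi> (2 * k + 1)) (\<Phi> (2 * k + 2)) (\<Phi> (2 * k' + 1))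
        = btw (\<Phi> (2 * k + 1)) (\<Phi> (2 * k + 2)) (\<Phi> (2 * k' + 2))"
    proof (cases "k = k'")
      case False
      then show ?thesis using nest1[of "k + 1" "k' + 1"] kk I
        by (simp add: \<Phi>_btw nested_def between_eq_btw)
    qed simp
    then show "btw (\<Phi> (Suc (2 * k))) (\<Phi> (Suc (Suc (2 * k)))) (\<Phi> (Suc (2 * k')))
        = btw (\<Phi> (Suc (2 * k))) (\<Phi> (Suc (Suc (2 * k)))) (\<Phi> (Suc (Suc (2 * k'))))" by simp
  qed
  moreover have "\<forall>p\<in>set cv. fst p \<in> {1..n} \<and> snd p \<noteq> 0"
  proof
    fix p assume "p \<in> set cv"
    then obtain k where k: "k < m" "p = \<Phi> (2 * k + 2)" by (auto simp: cv_def)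
    then show "fst p \<in> {1..n} \<and> snd p \<noteq> 0"
      using c_J[of "2 * k + 2"] sgn[of "2 * k + 2"] by (auto simp: \<Phi>_def)
  qed
  moreover have "distinct (map (\<lambda>p. (fst p, \<bar>snd p\<bar>)) cv)"
    unfolding distinct_conv_nth
  proof (intro allI impI)
    fix k k' assume "k < length (map (\<lambda>p. (fst p, \<bar>snd p\<bar>)) cv)"
      "k' < length (map (\<lambda>p. (fst p, \<bar>snd p\<bar>)) cv)" and ne: "k \<noteq> k'"
    then have kk: "k < m" "k' < m" by (auto simp: cv_def)
    have "\<Phi> (2 * k + 2) \<noteq> \<Phi> (2 * k' + 2)"
      using \<Phi>_inj[of "2 * k + 2" "2 * k' + 2"] kk ne by auto
    moreover have "2 * k + 2 \<noteq> 2 * k' + 3" by presburger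
    then have "\<Phi> (2 * k + 2) \<noteq> flip (\<Phi> (2 * k' + 2))"
      using \<Phi>_inj[of "2 * k + 2" "2 * k' + 3"] kk flip_\<Phi>'[of k'] by auto
    ultimately show "map (\<lambda>p. (fst p, \<bar>snd p\<bar>)) cv ! k \<noteq> map (\<lambda>p. (fst p, \<bar>snd p\<bar>)) cv ! k'"
      using kk by (auto simp: cv_def flip_def prod_eq_iff abs_eq_iff simp del: mult_Suc_right)
  qed
  ultimately have "curve n cv" by (simp add: curve_def)
  moreover have "word_of cv = w"
  proof (rule nth_equalityI)
    show "length (word_of cv) = length w" by (simp add: word_of_def cv_def m_def)
    fix k assume "k < length (word_of cv)"
    then have k: "k < m" by (simp add: word_of_def cv_def)
    have fst: "fst (\<Phi> (2 * k + 2)) = fst (w ! k)" using k by (simp add: \<Phi>_def idx_def)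
    have "c (2 * k + 2) = code (w ! k)"
      using nth_whitehead(1)[of k w n] k by (simp add: c_def m_def)
    moreover have "fst (w ! k) \<in> {1..n}" using c_J[of "2 * k + 2"] k by (simp add: idx_def)
    ultimately have "0 < snd (\<Phi> (2 * k + 2)) \<longleftrightarrow> snd (w ! k)"
      using sgn[of "2 * k + 2"] k fst by (auto simp: code_def split: if_splits)
    then show "word_of cv ! k = w ! k"
      using k fst by (simp add: word_of_def cv_def prod_eq_iff)
  qed
  ultimately show ?thesis using that by blast
qed

section \<open>Chords and their ends\<close>

lemma point_less_iff: "p < q \<longleftrightarrow> fst p < fst q \<or> fst p = fst q \<and> snd p < snd q" for p q :: point
  by (auto simp: less_prod_def)

lemma btw_iff: "btw a b x \<longleftrightarrow> (a < x \<or> b < x) \<and> (x < a \<or> x < b)"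
  by (simp add: btw_def min_less_iff_disj less_max_iff_disj)

lemma noncrossingD: "noncrossing A \<Longrightarrow> (a, b) \<in> A \<Longrightarrow> (c, d) \<in> A \<Longrightarrow> btw a b c = btw a b d"
  unfolding noncrossing_def by (metis fst_conv snd_conv)

lemma arcs_append: "arcs P (u @ x # v) E = arcs P u x @ arcs (flip x) v E"
  by (induction u arbitrary: P) simp_all

lemma arcs_split_last: "\<exists>A Q. \<forall>E. arcs P u E = A @ [(Q, E)]"
proof (induction u arbitrary: P)
  case (Cons x u)
  then obtain A Q where "\<And>E. arcs (flip x) u E = A @ [(Q, E)]" by blast
  then have "\<forall>E. arcs P (x # u) E = ((P, x) # A) @ [(Q, E)]" by simp
  then show ?case by blast
qed simp

lemma arcs_split_first: "\<exists>B N. \<forall>P. arcs P v E = (P, N) # B"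
  by (cases v) auto

text \<open>Isolates the chord across the seam of \<open>u\<close> and \<open>v\<close>: its ends
  \<open>Q\<close> and \<open>N\<close> stay the same when crossings are inserted at the
  seam.\<close>

lemma arcs_append_split:
  obtains A Q N B where "\<And>x. arcs P u x = A @ [(Q, x)]" "\<And>x. arcs x v E = (x, N) # B"
    "arcs P (u @ v) E = A @ (Q, N) # B"
proof -
  obtain A Q where AQ: "\<And>x. arcs P u x = A @ [(Q, x)]" using arcs_split_last by blast
  obtain B N where BN: "\<And>x. arcs x v E = (x, N) # B" using arcs_split_first by blast
  have "arcs P (u @ v) E = A @ (Q, N) # B"
  proof (cases v)
    case Nil
    then show ?thesis using AQ[of E] BN[of P] by simp
  next
    case (Cons y v')
    then show ?thesis using AQ[of y] BN[of P] by (auto simp: arcs_append)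
  qed
  then show thesis using that AQ BN by blast
qed

lemma arcs_points: "(a, b) \<in> set (arcs P c E) \<Longrightarrow> a \<in> insert P (flip ` set c) \<and> b \<in> insert E (set c)"
proof (induction c arbitrary: P)
  case (Cons x c)
  show ?case
  proof (cases "(a, b) = (P, x)")
    case False
    then have "(a, b) \<in> set (arcs (flip x) c E)" using Cons.prems by auto
    from Cons.IH[OF this] show ?thesis by auto
  qed simp
qed simp

text \<open>Lets one of the two tests that \<open>noncrossing\<close> makes for a pair of chords
  follow from the other. A shared end would break the symmetry, \<open>btw\<close> being strict.
  Swapping ends reduces everything to \<open>a \<le> b\<close> and \<open>c \<le> d\<close>.\<close>

lemma btw_sym:
  fixes a b c d :: "'a::linorder"
  assumes "a \<noteq> c" "a \<noteq> d" "b \<noteq> c" "b \<noteq> d" "btw a b c = btw a b d"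
  shows "btw c d a = btw c d b"
proof -
  have *: "(c < a \<and> a < d) = (c < b \<and> b < d)"
    if "a \<noteq> c" "a \<noteq> d" "b \<noteq> c" "b \<noteq> d" "(a < c \<and> c < b) = (a < d \<and> d < b)" "a \<le> b" "c \<le> d"
    for a b c d :: 'a
    using that by (meson linorder_neqE not_less_iff_gr_or_eq order.strict_trans order_le_less_trans)
  show ?thesis
  proof (cases "a \<le> b"; cases "c \<le> d")
    assume "a \<le> b" "c \<le> d"
    then show ?thesis using *[of a c d b] assms by (simp add: btw_def)
  next
    assume "a \<le> b" "\<not> c \<le> d"
    then show ?thesis using *[of a d c b] assms by (simp add: btw_def)
  next
    assume "\<not> a \<le> b" "c \<le> d"
    then show ?thesis using *[of b c d a] assms by (simp add: btw_def)
  next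
    assume "\<not> a \<le> b" "\<not> c \<le> d"
    then show ?thesis using *[of b d c a] assms by (simp add: btw_def)
  qed
qed

lemma map_fst_arcs: "map fst (arcs P c E) = P # map flip c"
  and map_snd_arcs: "map snd (arcs P c E) = c @ [E]"
  by (simp_all add: arcs_eq_zip)

text \<open>Chords start at flips of crossings and end at crossings, apart from the base point. A
  coincidence between different chords would make two crossings share ray and height, or make a
  crossing equal to its own flip.\<close>

lemma curve_arc_points:
  assumes c: "\<forall>p\<in>set c. fst p \<in> {1..n} \<and> snd p \<noteq> 0" "distinct (map (\<lambda>p. (fst p, \<bar>snd p\<bar>)) c)"
    and ab: "a \<in> set (curve_arcs n c)" "b \<in> set (curve_arcs n c)" "a \<noteq> b"
  shows "fst a \<noteq> fst b \<and> fst a \<noteq> snd b \<and> snd a \<noteq> fst b \<and> snd a \<noteq> snd b"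
proof -
  have inj: "p = q" if "p \<in> set c" "q \<in> set c" "fst p = fst q" "\<bar>snd p\<bar> = \<bar>snd q\<bar>" for p q
    using c(2) that by (simp add: distinct_map inj_on_def)
  have "distinct c" using c(2) by (simp add: distinct_map)
  moreover have "inj_on flip (set c)" by (simp add: inj_on_def)
  moreover have "fst p \<noteq> 0 \<and> fst p \<noteq> Suc n" if "p \<in> set c" for p using c(1) that by force
  ultimately have d: "distinct (map fst (curve_arcs n c))" "distinct (map snd (curve_arcs n c))"
    unfolding map_fst_arcs map_snd_arcs by (force simp: distinct_map flip_def)+
  have "fst a \<noteq> fst b" "snd a \<noteq> snd b"
    using d ab by (auto simp: distinct_map dest: inj_onD)
  moreover have "x \<noteq> y" if x: "x \<in> set ((0, 1) # map flip c)" and y: "y \<in> set (c @ [(Suc n, -1)])" for x y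
  proof
    assume "x = y"
    have "fst p \<in> {1..n}" "snd p \<noteq> 0" if "p \<in> set c" for p using c(1) that by auto
    then obtain p where p: "p \<in> set c" "x = flip p" "y \<in> set c" using x y \<open>x = y\<close> by fastforce
    then have "p = y" using inj[of p y] \<open>x = y\<close> by auto
    then show False using p \<open>x = y\<close> c(1) by (auto simp: flip_def prod_eq_iff)
  qed
  moreover have "fst ` set (curve_arcs n c) = set ((0, 1) # map flip c)"
    "snd ` set (curve_arcs n c) = set (c @ [(Suc n, -1)])"
    by (simp_all flip: set_map add: map_fst_arcs map_snd_arcs)
  ultimately show ?thesis using ab by (metis imageI)
qed

section \<open>Free reduction of curves\<close>

text \<open>The two crossings bound a segment of the ray that the rest of the curve misses. Seen
  from the other side of the ray, no point separates \<open>x\<close> from \<open>flip y\<close>, so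
  the chord arriving at \<open>x\<close> and the one leaving from \<open>flip y\<close> can be
  joined.\<close>

lemma curve_remove_bigon:
  assumes cv: "curve n (u @ x # y # v)" and xy: "fst x = fst y" "snd x * snd y < 0"
    and inner: "\<And>p. p \<in> set (u @ v) \<union> flip ` set (u @ v) \<Longrightarrow> \<not> btw (flip x) y p"
  shows "curve n (u @ v)"
proof -
  let ?c = "u @ x # y # v" and ?c' = "u @ v"
  obtain A Q N B where sp: "\<And>x. arcs (0, 1) u x = A @ [(Q, x)]"
    "\<And>x. arcs x v (Suc n, -1) = (x, N) # B" "curve_arcs n ?c' = A @ (Q, N) # B"
    using arcs_append_split[of "(0, 1)" u v "(Suc n, -1)"] by blast
  have arcs: "curve_arcs n ?c = A @ (Q, x) # (flip x, y) # (flip y, N) # B"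
    by (simp add: arcs_append sp)
  have c': "\<forall>p\<in>set ?c'. fst p \<in> {1..n} \<and> snd p \<noteq> 0" "distinct (map (\<lambda>p. (fst p, \<bar>snd p\<bar>)) ?c')"
    and nx: "fst x \<in> {1..n}" "snd x \<noteq> 0" "snd y \<noteq> 0"
    using cv by (auto simp: curve_def)
  define K where "K p = (fst p, \<bar>snd p\<bar>)" for p :: point
  have keys: "K p \<noteq> K x \<and> K p \<noteq> K y" if "p \<in> set ?c' \<union> flip ` set ?c'" for p
  proof -
    have "distinct (map K ?c)" using cv by (simp add: curve_def K_def[abs_def])
    then have "K x \<notin> K ` set ?c'" "K y \<notin> K ` set ?c'" by auto
    moreover have "K p \<in> K ` set ?c'"
      using that
    proof
      assume "p \<in> flip ` set ?c'"
      then obtain q where "q \<in> set ?c'" "p = flip q" by blast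
      then show ?thesis by (metis K_def abs_minus_cancel fst_flip imageI snd_flip)
    qed (rule imageI)
    ultimately show ?thesis by metis
  qed
  have side: "p < x \<longleftrightarrow> p < flip y" "x < p \<longleftrightarrow> flip y < p"
    if p: "p \<in> insert (0, 1) (flip ` set ?c') \<union> insert (Suc n, -1) (set ?c')" for p
  proof -
    have "(p < x \<longleftrightarrow> p < flip y) \<and> (x < p \<longleftrightarrow> flip y < p)"
    proof (cases "fst p = fst x")
      case False
      then show ?thesis using xy by (simp add: point_less_iff)
    next
      case True
      then have p: "p \<in> set ?c' \<union> flip ` set ?c'" using that nx(1) by fastforce
      then have "flip p \<in> set ?c' \<union> flip ` set ?c'" by force
      from inner[OF this] have "\<not> btw (flip x) y (flip p)" .
      then have "\<not> ((- snd x < - snd p \<or> snd y < - snd p) \<and> (- snd p < - snd x \<or> - snd p < snd y))"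
        using True xy(1) unfolding btw_iff unfolding point_less_iff by simp
      moreover have "\<bar>snd p\<bar> \<noteq> \<bar>snd x\<bar>" "\<bar>snd p\<bar> \<noteq> \<bar>snd y\<bar>" using True keys[OF p] xy by (simp_all add: K_def)
      moreover have "snd x < 0 \<and> snd y > 0 \<or> snd x > 0 \<and> snd y < 0" using xy(2) by (auto simp: mult_less_0_iff)
      ultimately have "(snd p < snd x \<longleftrightarrow> snd p < - snd y) \<and> (snd x < snd p \<longleftrightarrow> - snd y < snd p)"
        by (smt (verit))
      then show ?thesis using True xy by (simp add: point_less_iff)
    qed
    then show "p < x \<longleftrightarrow> p < flip y" "x < p \<longleftrightarrow> flip y < p" by auto
  qed
  have nc: "btw (fst a) (snd a) (fst b) = btw (fst a) (snd a) (snd b)"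
    if "a \<in> set (curve_arcs n ?c)" "b \<in> set (curve_arcs n ?c)" for a b
    using cv that unfolding curve_def noncrossing_def by blast
  \<comment> \<open>\<open>Q\<close> is compared with \<open>x\<close>, then \<open>x\<close> with
    \<open>flip y\<close>, then \<open>flip y\<close> with \<open>N\<close>; the two outer
    comparisons come from chords of the old curve.\<close>
  have old: "btw (fst b) (snd b) Q = btw (fst b) (snd b) N" if b: "b \<in> set A \<union> set B" for b
  proof -
    have "(fst b, snd b) \<in> set (curve_arcs n ?c')" using b sp(3) by auto
    from arcs_points[OF this]
    have *: "fst b \<in> insert (0, 1) (flip ` set ?c') \<union> insert (Suc n, -1) (set ?c')"
      "snd b \<in> insert (0, 1) (flip ` set ?c') \<union> insert (Suc n, -1) (set ?c')" by blast+
    have "btw (fst b) (snd b) Q = btw (fst b) (snd b) x"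
      "btw (fst b) (snd b) (flip y) = btw (fst b) (snd b) N"
      using nc[of b "(Q, x)"] nc[of b "(flip y, N)"] b by (simp_all add: arcs)
    moreover have "btw (fst b) (snd b) x = btw (fst b) (snd b) (flip y)"
      by (simp only: btw_iff side[OF *(1)] side[OF *(2)])
    ultimately show ?thesis by blast
  qed
  have "btw (fst a) (snd a) (fst b) = btw (fst a) (snd a) (snd b)"
    if a: "a \<in> set (curve_arcs n ?c')" and b: "b \<in> set (curve_arcs n ?c')" for a b
  proof (cases "a = b")
    case True
    then show ?thesis by (auto simp: btw_def)
  next
    case False
    consider "b = (Q, N)" "a \<in> set A \<union> set B" | "a = (Q, N)" "b \<in> set A \<union> set B"
      | "a \<in> set A \<union> set B" "b \<in> set A \<union> set B"
      using a b False unfolding sp(3) by auto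
    then show ?thesis
    proof cases
      case 1
      then show ?thesis using old by simp
    next
      case 2
      show ?thesis
        using curve_arc_points[OF c' a b False] old[OF 2(2)] unfolding 2(1)
        by (metis btw_sym fst_conv snd_conv)
    next
      case 3
      then show ?thesis by (intro nc) (auto simp: arcs)
    qed
  qed
  then show ?thesis using c' unfolding curve_def noncrossing_def by blast
qed

lemma not_reduced_nth: "\<not> reduced w \<Longrightarrow> \<exists>k. Suc k < length w \<and> w ! Suc k = inv_letter (w ! k)"
proof (induction w rule: reduced.induct)
  case (3 x y ys)
  show ?case
  proof (cases "y = inv_letter x")
    case True
    then show ?thesis by (intro exI[of _ 0]) auto
  next
    case False
    then show ?thesis using 3 by fastforce
  qed
qed auto

text \<open>Take a bigon of least width. An end inside its chord brings a whole chord inside, by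
  noncrossing; that chord again joins two points on the same side of the same ray and so belongs to
  a narrower bigon.\<close>

lemma curve_innermost_bigon:
  assumes cv: "curve n c" and nr: "\<not> reduced (word_of c)"
  obtains u x y v where "c = u @ x # y # v" "fst x = fst y" "snd x * snd y < 0"
    "\<And>p. p \<in> set c \<union> flip ` set c \<Longrightarrow> \<not> btw (flip x) y p"
proof -
  define bad where "bad k \<longleftrightarrow> Suc k < length c \<and> fst (c ! k) = fst (c ! Suc k) \<and> snd (c ! k) * snd (c ! Suc k) < 0" for k
  \<comment> \<open>The chord starts at \<open>flip (c ! k)\<close>, with second coordinate
    \<open>- snd (c ! k)\<close>; hence this sum is the distance between its ends.\<close>
  define wd where "wd k = nat \<bar>snd (c ! k) + snd (c ! Suc k)\<bar>" for k
  have rng: "1 \<le> fst (c ! j) \<and> fst (c ! j) \<le> n \<and> snd (c ! j) \<noteq> 0" if "j < length c" for j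
    using cv that unfolding curve_def by (meson atLeastAtMost_iff nth_mem)
  obtain k0 where "Suc k0 < length c" "word_of c ! Suc k0 = inv_letter (word_of c ! k0)"
    using not_reduced_nth[OF nr] by (auto simp: word_of_def)
  then have "bad k0" using rng[of k0] rng[of "Suc k0"]
    by (auto simp: bad_def word_of_def mult_less_0_iff)
  then obtain k where k: "bad k" "\<And>j. bad j \<Longrightarrow> wd k \<le> wd j"
    using arg_min_natI[of bad k0 wd] arg_min_nat_le[of bad _ wd] by blast
  let ?x = "c ! k" and ?y = "c ! Suc k"
  have len: "Suc k < length c" using k by (simp add: bad_def)
  have arc: "(flip ?x, ?y) \<in> set (curve_arcs n c)"
    using len nth_mem[of "Suc k" "curve_arcs n c"] by (simp add: nth_arcs nth_append)
  have "\<not> btw (flip ?x) ?y p" if p: "p \<in> set c \<union> flip ` set c" for p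
  proof
    assume b: "btw (flip ?x) ?y p"
    obtain j where j: "j \<le> length c" "p = ((0, 1) # map flip c) ! j \<or> p = (c @ [(Suc n, -1)]) ! j"
    proof -
      from p consider i where "i < length c" "p = c ! i" | i where "i < length c" "p = flip (c ! i)"
        by (auto simp: in_set_conv_nth)
      then show thesis
      proof cases
        case 1
        then show thesis using that[of i] by (simp add: nth_append)
      next
        case 2
        then show thesis using that[of "Suc i"] by simp
      qed
    qed
    let ?L = "((0, 1) # map flip c) ! j" and ?R = "(c @ [(Suc n, -1)]) ! j"
    have "(?L, ?R) \<in> set (curve_arcs n c)"
      using j(1) nth_mem[of j "curve_arcs n c"] by (simp add: nth_arcs)
    then have "btw (flip ?x) ?y ?L = btw (flip ?x) ?y ?R"
      using cv arc noncrossingD unfolding curve_def by blast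
    then have LR: "btw (flip ?x) ?y ?L" "btw (flip ?x) ?y ?R" using b j(2) by auto
    have "fst ?x = fst ?y" using k(1) by (simp add: bad_def)
    then have inb: "fst q = fst ?x \<and> min (- snd ?x) (snd ?y) < snd q \<and> snd q < max (- snd ?x) (snd ?y)"
      if "btw (flip ?x) ?y q" for q
      using that unfolding btw_iff point_less_iff min_less_iff_disj less_max_iff_disj by auto
    have "j \<noteq> 0" using inb[OF LR(1)] rng[of k] len by (cases j) auto
    then obtain i where i: "j = Suc i" by (cases j) auto
    have "j \<noteq> length c" using inb[OF LR(2)] rng[of k] len by (auto simp: nth_append)
    then have jl: "Suc i < length c" using j(1) i by simp
    have "?L = flip (c ! i)" "?R = c ! Suc i" using i jl by (auto simp: nth_append)
    then have in_i: "fst (c ! i) = fst ?x" "fst (c ! Suc i) = fst ?x"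
      "min (- snd ?x) (snd ?y) < - snd (c ! i)" "- snd (c ! i) < max (- snd ?x) (snd ?y)"
      "min (- snd ?x) (snd ?y) < snd (c ! Suc i)" "snd (c ! Suc i) < max (- snd ?x) (snd ?y)"
      using inb[OF LR(1)] inb[OF LR(2)] by simp_all
    have "snd ?x < 0 \<and> snd ?y > 0 \<or> snd ?x > 0 \<and> snd ?y < 0"
      using k(1) by (auto simp: bad_def mult_less_0_iff)
    then have "(snd (c ! i) < 0 \<and> snd (c ! Suc i) > 0 \<or> snd (c ! i) > 0 \<and> snd (c ! Suc i) < 0)
        \<and> \<bar>snd (c ! i) + snd (c ! Suc i)\<bar> < \<bar>snd ?x + snd ?y\<bar>"
      using in_i(3-6) unfolding min_def max_def by (smt (verit))
    then have "bad i \<and> wd i < wd k"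
      using in_i(1,2) jl unfolding bad_def wd_def by (auto simp: mult_less_0_iff)
    then show False using k(2)[of i] by simp
  qed
  moreover have "c = take k c @ ?x # ?y # drop (Suc (Suc k)) c"
    using len by (simp add: Cons_nth_drop_Suc)
  ultimately show thesis using that k(1) unfolding bad_def by blast
qed

lemma word_of_append [simp]: "word_of (u @ v) = word_of u @ word_of v"
  and word_of_Cons: "word_of (x # v) = (fst x, snd x > 0) # word_of v"
  and length_word_of [simp]: "length (word_of c) = length c"
  by (simp_all add: word_of_def)

text \<open>All orders of cancellation lead to the same reduced word, so the cancellations may be
  performed at innermost bigons, where the curve stays simple.\<close>

lemma curve_reduce: "curve n c \<Longrightarrow> \<exists>c'. curve n c' \<and> word_of c' = reduce (word_of c)"
proof (induction "length c" arbitrary: c rule: less_induct)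
  case less
  show ?case
  proof (cases "reduced (word_of c)")
    case True
    then show ?thesis using less.prems reduce_reduced by metis
  next
    case False
    then obtain u x y v where uv: "c = u @ x # y # v" "fst x = fst y" "snd x * snd y < 0"
      "\<And>p. p \<in> set c \<union> flip ` set c \<Longrightarrow> \<not> btw (flip x) y p"
      using curve_innermost_bigon[OF less.prems] by metis
    have "curve n (u @ v)"
      using less.prems uv by (intro curve_remove_bigon[of n u x y v]) auto
    then obtain c' where c': "curve n c'" "word_of c' = reduce (word_of (u @ v))"
      using less.hyps[of "u @ v"] uv(1) by auto
    have "word_of [x, y] = [(fst x, snd x > 0), inv_letter (fst x, snd x > 0)]"
      using uv(2,3) by (auto simp: word_of_def mult_less_0_iff)
    then have "word_of c = word_of u @ (fst x, snd x > 0) # inv_letter (fst x, snd x > 0) # word_of v"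
      unfolding uv(1) by (simp add: word_of_Cons)
    also have "\<dots> \<approx> word_of u @ word_of v"
      by (intro feq_append feq_refl feq_cancel_pair)
    finally show ?thesis using c' by (auto simp: feq_def)
  qed
qed

lemma curve_range: "curve n c \<Longrightarrow> p \<in> set c \<Longrightarrow> fst p \<in> {1..n} \<and> snd p \<noteq> 0"
  unfolding curve_def by blast

lemma curve_noncrossing: "curve n c \<Longrightarrow> noncrossing (set (curve_arcs n c))"
  unfolding curve_def by blast

lemma noncrossing_mono: "noncrossing A \<Longrightarrow> A' \<subseteq> A \<Longrightarrow> noncrossing A'"
  unfolding noncrossing_def by blast

section \<open>Moving a ray to the left\<close>

text \<open>
  The new ray, which becomes \<open>r\<^sub>i\<close>, separates the points satisfying \<open>low\<close> from the others. Every end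
  \<open>p\<close> of a chord with \<open>low p\<close> is pulled across it, at height \<open>ht p\<close>; \<open>F\<close> gives the new position of
  an end, and the only new chords run from \<open>G p\<close> to \<open>H p\<close>, where \<open>H p\<close> is \<open>p\<close> after renumbering. \<open>B\<close>
  bounds the heights of the old curve.
\<close>

locale left_shift =
  fixes i j n :: nat and B :: int
  assumes i_pos: "1 \<le> i" and i_less_j: "i < j" and j_le_n: "j \<le> n" and B_pos: "1 \<le> B"
begin

definition low :: "point \<Rightarrow> bool" where
  "low p \<longleftrightarrow> i \<le> fst p \<and> fst p < j \<or> fst p = j \<and> snd p < 0"

definition mid :: "point \<Rightarrow> bool" where
  "mid p \<longleftrightarrow> i \<le> fst p \<and> fst p < j"

definition valid :: "point \<Rightarrow> bool" where
  "valid p \<longleftrightarrow> snd p \<noteq> 0 \<and> \<bar>snd p\<bar> \<le> B"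

text \<open>Turns the reversed lexicographic order into heights. For
  \<open>\<bar>snd p\<bar> \<le> B\<close> the last summand lies between 1 and
  \<open>2 * B + 1\<close>, so steps of \<open>2 * B + 2\<close> keep different rays in disjoint
  ranges.\<close>

definition ht :: "point \<Rightarrow> int" where
  "ht p = (int j - int (fst p)) * (2 * B + 2) + (B + 1 - snd p)"

text \<open>Ends on the right side of \<open>r_j\<close> are not low, but their ray disappears: they
  move to the right side of the new ray, opposite to the image of their flip.\<close>

definition F :: "point \<Rightarrow> point" where
  "F p = (if low p then (i, - ht p) else if fst p = j then (i, ht (flip p)) else p)"

definition G :: "point \<Rightarrow> point" where
  "G p = (i, ht p)"

definition H :: "point \<Rightarrow> point" where
  "H p = (Suc (fst p), snd p)"

text \<open>A crossing of a ray that is passed over becomes an entry through the new ray, the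
  crossing of the renumbered ray and an exit, matching the three letters of
  \<open>left_move\<close>.\<close>

definition sub :: "point \<Rightarrow> point list" where
  "sub p = (if mid p then [F p, H p, G (flip p)] else [F p])"

section \<open>The order of the ends after the move\<close>

lemma valid_flip [simp]: "valid (flip p) \<longleftrightarrow> valid p"
  by (simp add: valid_def)

lemma mid_flip [simp]: "mid (flip p) \<longleftrightarrow> mid p"
  by (simp add: mid_def)

lemma mid_low: "mid p \<Longrightarrow> low p"
  by (simp add: mid_def low_def)

lemma ht_pos: "fst p \<le> j \<Longrightarrow> valid p \<Longrightarrow> 0 < ht p"
proof -
  assume "fst p \<le> j" "valid p"
  then have "0 \<le> (int j - int (fst p)) * (2 * B + 2)" "0 < B + 1 - snd p"
    using B_pos by (auto simp: valid_def)
  then show ?thesis by (simp add: ht_def)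
qed

lemma ht_antimono:
  assumes "fst q \<le> j" "valid p" "valid q" "p < q"
  shows "ht q < ht p"
proof (cases "fst p = fst q")
  case True
  then show ?thesis using assms(4) by (simp add: ht_def point_less_iff)
next
  case False
  then have "int (fst p) + 1 \<le> int (fst q)" using assms(4) by (auto simp: point_less_iff)
  then have "(int j - int (fst q) + 1) * (2 * B + 2) \<le> (int j - int (fst p)) * (2 * B + 2)"
    using B_pos by (intro mult_right_mono) auto
  moreover have "snd p \<le> B" "- B \<le> snd q" using assms by (auto simp: valid_def)
  ultimately show ?thesis by (simp add: ht_def algebra_simps)
qed

lemma ht_less_iff:
  assumes "fst p \<le> j" "fst q \<le> j" "valid p" "valid q"
  shows "ht q < ht p \<longleftrightarrow> p < q"
  using ht_antimono[of q p] ht_antimono[of p q] assms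
  by (cases p q rule: linorder_cases) auto

lemma ht_eq_iff:
  assumes "fst p \<le> j" "fst q \<le> j" "valid p" "valid q"
  shows "ht q = ht p \<longleftrightarrow> p = q"
  using ht_antimono[of q p] ht_antimono[of p q] assms
  by (cases p q rule: linorder_cases) auto

lemma F_cases:
  assumes "valid p"
  obtains (left) "fst p < i" "F p = p"
  | (low) "low p" "F p = (i, - ht p)" "i \<le> fst p" "fst p \<le> j"
  | (up) "fst p = j" "0 < snd p" "low (flip p)" "F p = (i, ht (flip p))" "\<not> low p"
  | (right) "j < fst p" "F p = p"
proof -
  consider "fst p < i" | "low p" | "fst p = j" "0 < snd p" | "j < fst p"
    using assms unfolding low_def valid_def by linarith
  then show thesis
  proof cases
    case 1
    then show ?thesis using left i_less_j by (simp add: F_def low_def)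
  next
    case 2
    then show ?thesis using low i_less_j by (auto simp: F_def low_def)
  next
    case 3
    then show ?thesis using up by (simp add: F_def low_def)
  next
    case 4
    then show ?thesis using right by (simp add: F_def low_def)
  qed
qed

text \<open>Low points are consecutive in the order. Heights reverse them and the negative sign
  restores their order; on the new ray they occupy the left side, and the points from the right side
  of \<open>r_j\<close> follow on its right side.\<close>

lemma F_mono:
  assumes "valid p" "valid q" "p < q"
  shows "F p < F q"
proof -
  have le: "fst p \<le> fst q" using assms(3) by (auto simp: point_less_iff)
  have htp: "0 < ht p" if "fst p \<le> j" using ht_pos assms that by blast
  have htq: "0 < ht (flip q)" if "fst q \<le> j" using ht_pos[of "flip q"] assms that by simp
  from assms(1) show ?thesis
  proof (cases rule: F_cases)
    case left
    from assms(2) show ?thesis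
      by (cases rule: F_cases) (use left le assms(3) in \<open>auto simp: point_less_iff\<close>)
  next
    case p: low
    from assms(2) show ?thesis
    proof (cases rule: F_cases)
      case low
      then show ?thesis using p ht_antimono[of q p] assms by (simp add: point_less_iff)
    next
      case up
      then show ?thesis using p htp htq by (simp add: point_less_iff)
    qed (use p le i_less_j in \<open>auto simp: point_less_iff\<close>)
  next
    case p: up
    from assms(2) show ?thesis
    proof (cases rule: F_cases)
      case up
      have "flip q < flip p" using assms(3) p up by (auto simp: point_less_iff)
      then show ?thesis using p up ht_antimono[of "flip p" "flip q"] assms by (simp add: point_less_iff)
    next
      case low
      then have False using p le assms(3) unfolding low_def point_less_iff by auto
      then show ?thesis ..
    qed (use p le i_less_j in \<open>auto simp: point_less_iff\<close>)
  next
    case p: right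
    from assms(2) show ?thesis
      by (cases rule: F_cases) (use p le assms(3) in auto)
  qed
qed

lemma F_less_iff:
  assumes "valid p" "valid q"
  shows "F p < F q \<longleftrightarrow> p < q"
  using F_mono[of p q] F_mono[of q p] assms by (cases p q rule: linorder_cases) auto

lemma G_less_H: "mid p \<Longrightarrow> mid q \<Longrightarrow> G p < H q"
  by (simp add: G_def H_def mid_def point_less_iff)

lemma H_less_iff: "H p < H q \<longleftrightarrow> p < q"
  by (simp add: H_def point_less_iff)

lemma G_less_iff: "mid p \<Longrightarrow> mid q \<Longrightarrow> valid p \<Longrightarrow> valid q \<Longrightarrow> G p < G q \<longleftrightarrow> q < p"
  using ht_less_iff[of q p] by (simp add: G_def mid_def point_less_iff)

text \<open>The only images on the right side of the new ray come from \<open>r_j\<close>, and since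
  \<open>p\<close> precedes \<open>r_j\<close> they lie closer to the puncture than
  \<open>G p\<close>. So the new chords can be inserted without crossing the images of old
  ones.\<close>

lemma F_gap:
  assumes "valid q" "mid p" "valid p"
  shows "F q < G p \<and> F q < H p \<or> G p < F q \<and> H p < F q"
proof -
  have p: "i \<le> fst p" "fst p < j" "0 < ht p" using assms ht_pos by (auto simp: mid_def)
  from assms(1) show ?thesis
  proof (cases rule: F_cases)
    case low
    then show ?thesis using p ht_pos[of q] assms(1) by (simp add: G_def H_def point_less_iff)
  next
    case up
    have "p < flip q" using p up by (simp add: point_less_iff)
    then have "ht (flip q) < ht p" using ht_antimono[of "flip q" p] up assms by simp
    then show ?thesis using up p by (simp add: G_def H_def point_less_iff)
  qed (use p i_less_j in \<open>auto simp: G_def H_def point_less_iff\<close>)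
qed

lemma flip_F: "valid p \<Longrightarrow> \<not> mid p \<Longrightarrow> flip (F p) = F (flip p)"
  using i_less_j by (auto simp: F_def low_def mid_def valid_def)

lemma flip_F_mid: "mid p \<Longrightarrow> flip (F p) = G p"
  by (simp add: F_def G_def mid_low)

lemma flip_G_mid: "mid p \<Longrightarrow> flip (G (flip p)) = F (flip p)"
  by (simp add: F_def G_def mid_low)

lemma flip_H: "flip (H p) = H (flip p)"
  by (simp add: H_def flip_def)

section \<open>Chords after the move\<close>

definition gap_arcs :: "(point \<times> point) set" where
  "gap_arcs = {(G p, H p) | p. mid p \<and> valid p} \<union> {(H p, G p) | p. mid p \<and> valid p}"

lemma arcs_sub:
  assumes "\<forall>p\<in>set c. valid p" "F E = E"
  shows "set (arcs (F P) (concat (map sub c)) E) \<subseteq> map_prod F F ` set (arcs P c E) \<union> gap_arcs"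
  using assms(1)
proof (induction c arbitrary: P)
  case Nil
  then show ?case using assms(2) by force
next
  case (Cons x c)
  have x: "valid x" using Cons.prems by simp
  have IH: "set (arcs (F (flip x)) (concat (map sub c)) E)
      \<subseteq> map_prod F F ` set (arcs (flip x) c E) \<union> gap_arcs"
    using Cons by simp
  have first: "(F P, F x) \<in> map_prod F F ` set (arcs P (x # c) E)" by force
  have rest: "map_prod F F ` set (arcs (flip x) c E) \<subseteq> map_prod F F ` set (arcs P (x # c) E)"
    by (intro image_mono) auto
  have split: "set (arcs (F P) (concat (map sub (x # c))) E)
      \<subseteq> {(F P, F x)} \<union> gap_arcs \<union> set (arcs (F (flip x)) (concat (map sub c)) E)"
  proof (cases "mid x")
    case True
    then have "(G x, H x) \<in> gap_arcs" "(H (flip x), G (flip x)) \<in> gap_arcs"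
      using x mid_flip[of x] valid_flip[of x] unfolding gap_arcs_def by blast+
    then show ?thesis using True by (auto simp: sub_def flip_F_mid flip_G_mid flip_H)
  next
    case False
    then show ?thesis using x by (auto simp: sub_def flip_F)
  qed
  show ?case
    using first by (intro order_trans[OF split] Un_least order_trans[OF IH] Un_mono[OF rest]) auto
qed

lemma noncrossing_sub:
  assumes nc: "noncrossing A" and val: "\<And>a b. (a, b) \<in> A \<Longrightarrow> valid a \<and> valid b"
  shows "noncrossing (map_prod F F ` A \<union> gap_arcs)"
proof -
  have FF: "btw (F a) (F b) (F c) = btw (F a) (F b) (F d)" if "(a, b) \<in> A" "(c, d) \<in> A" for a b c d
  proof -
    have "btw (F a) (F b) (F q) = btw a b q" if "valid q" for q
      using val[OF \<open>(a, b) \<in> A\<close>] that unfolding btw_iff by (simp add: F_less_iff)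
    then show ?thesis using noncrossingD[OF nc that] val[OF that(2)] by simp
  qed
  have gap: "btw (F a) (F b) (G p) = btw (F a) (F b) (H p)" if "valid a" "valid b" "mid p" "valid p" for a b p
    using F_gap[OF that(1,3,4)] F_gap[OF that(2,3,4)] unfolding btw_iff by (metis less_asym)
  have out: "\<not> btw (G p) (H p) (F q)" "\<not> btw (H p) (G p) (F q)" if "valid q" "mid p" "valid p" for p q
    using F_gap[OF that] unfolding btw_iff by (metis less_asym)+
  \<comment> \<open>All points \<open>G\<close> precede all points \<open>H\<close>, and the two
    families run in opposite orders, so the new chords lie one inside another.\<close>
  have GH: "btw (G p) (H p) (G q) = btw (G p) (H p) (H q)"
    if "mid p" "valid p" "mid q" "valid q" for p q
    using G_less_H[OF that(1,3)] G_less_H[OF that(3,1)] G_less_H[OF that(1,1)] that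
    unfolding btw_iff by (auto simp: G_less_iff H_less_iff dest: less_asym)
  have "btw (fst a) (snd a) (fst b) = btw (fst a) (snd a) (snd b)"
    if a: "a \<in> map_prod F F ` A \<union> gap_arcs" and b: "b \<in> map_prod F F ` A \<union> gap_arcs" for a b
  proof -
    have arc_cases: "(\<exists>x y. (x, y) \<in> A \<and> r = (F x, F y)) \<or> (\<exists>p. mid p \<and> valid p \<and> (r = (G p, H p) \<or> r = (H p, G p)))"
      if "r \<in> map_prod F F ` A \<union> gap_arcs" for r
      using that unfolding gap_arcs_def by auto
    from arc_cases[OF a] show ?thesis
    proof (elim disjE exE conjE)
      fix x y assume xy: "(x, y) \<in> A" "a = (F x, F y)"
      from arc_cases[OF b] show ?thesis
        using FF[OF xy(1)] gap[of x y] val[OF xy(1)] unfolding xy(2) by auto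
    next
      fix p assume p: "mid p" "valid p" "a = (G p, H p)"
      from arc_cases[OF b] show ?thesis
        using out(1)[OF _ p(1,2)] GH[OF p(1,2)] val unfolding p(3) by auto
    next
      fix p assume p: "mid p" "valid p" "a = (H p, G p)"
      from arc_cases[OF b] show ?thesis
        using out(2)[OF _ p(1,2)] GH[OF p(1,2)] val unfolding p(3) fst_conv snd_conv btw_commute[of "H p" "G p"] by auto
    qed
  qed
  then show ?thesis unfolding noncrossing_def by blast
qed


section \<open>Crossings after the move\<close>

abbreviation key :: "point \<Rightarrow> nat \<times> int" where
  "key p \<equiv> (fst p, \<bar>snd p\<bar>)"

text \<open>Bounds the keys of the crossings that replace \<open>x\<close> by a set depending only
  on the key of \<open>x\<close>, so distinctness after the move becomes disjointness of these
  sets.\<close>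

definition key_set :: "point \<Rightarrow> (nat \<times> int) set" where
  "key_set x = {(i, ht p) | p. key p = key x \<and> fst p \<le> j \<and> i \<le> fst p}
     \<union> (if mid x then {key (H x)} else {}) \<union> (if fst x < i \<or> j < fst x then {key x} else {})"

lemma ht_in_key_set: "key p = key x \<Longrightarrow> i \<le> fst p \<Longrightarrow> fst p \<le> j \<Longrightarrow> (i, ht p) \<in> key_set x"
  unfolding key_set_def by blast

lemma key_sub:
  assumes "valid x" "r \<in> set (sub x)"
  shows "key r \<in> key_set x"
proof (cases "mid x")
  case True
  then have "low x" "low (flip x)" "i \<le> fst x" "fst x \<le> j" by (auto simp: mid_low mid_def)
  then have "0 < ht x" "0 < ht (flip x)" using ht_pos assms(1) by auto
  then have r: "r = H x \<or> key r = (i, ht x) \<or> key r = (i, ht (flip x))"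
    using assms(2) True \<open>low x\<close> by (auto simp: sub_def F_def G_def)
  have kf: "key (flip x) = key x" by simp
  have "(i, ht x) \<in> key_set x" "(i, ht (flip x)) \<in> key_set x"
    using \<open>i \<le> fst x\<close> \<open>fst x \<le> j\<close> kf by (intro ht_in_key_set; simp)+
  moreover have "key (H x) \<in> key_set x" using True by (simp add: key_set_def)
  ultimately show ?thesis using r by (elim disjE) simp_all
next
  case False
  then have r: "r = F x" using assms(2) by (simp add: sub_def)
  from assms(1) show ?thesis
  proof (cases rule: F_cases)
    case low
    then have "key r = (i, ht x)" using r ht_pos[of x] assms(1) by simp
    then show ?thesis using ht_in_key_set[of x x] low by metis
  next
    case up
    have "key r = (i, ht (flip x))" using r up ht_pos[of "flip x"] assms(1) by simp
    moreover have "(i, ht (flip x)) \<in> key_set x"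
      using up i_less_j by (intro ht_in_key_set) simp_all
    ultimately show ?thesis by metis
  qed (use r in \<open>auto simp: key_set_def\<close>)
qed

text \<open>Keys on the new ray, on the renumbered rays \<open>i + 1\<close> to \<open>j\<close>,
  and on the untouched rays cannot be confused. On the new ray the height determines the old point,
  \<open>ht\<close> being injective.\<close>

lemma key_set_disjoint:
  assumes "valid x" "valid y" "k \<in> key_set x" "k \<in> key_set y"
  shows "key x = key y"
proof -
  have val: "valid p" if "key p = key z" "valid z" for p z
    using that by (auto simp: valid_def)
  have *: "(\<exists>p. k = (i, ht p) \<and> key p = key z \<and> fst p \<le> j) \<or> mid z \<and> k = (Suc (fst z), \<bar>snd z\<bar>)
      \<or> (fst z < i \<or> j < fst z) \<and> k = key z" if "k \<in> key_set z" for z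
    using that by (auto simp: key_set_def H_def split: if_splits)
  from *[OF assms(3)] show ?thesis
  proof (elim disjE exE conjE)
    fix p assume p: "k = (i, ht p)" "key p = key x" "fst p \<le> j"
    from *[OF assms(4)] show ?thesis
    proof (elim disjE exE conjE)
      fix q assume q: "k = (i, ht q)" "key q = key y" "fst q \<le> j"
      then have "ht q = ht p" using p by simp
      then have "p = q" using ht_eq_iff[of p q] p q val assms(1,2) by blast
      then show ?thesis using p q by simp
    qed (use p i_less_j in \<open>auto simp: mid_def\<close>)
  next
    assume x: "mid x" "k = (Suc (fst x), \<bar>snd x\<bar>)"
    from *[OF assms(4)] show ?thesis
      by (elim disjE exE conjE) (use x in \<open>auto simp: mid_def\<close>)
  next
    assume x: "fst x < i" "k = key x"
    from *[OF assms(4)] show ?thesis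
      by (elim disjE exE conjE) (use x i_less_j in \<open>auto simp: mid_def\<close>)
  next
    assume x: "j < fst x" "k = key x"
    from *[OF assms(4)] show ?thesis
      by (elim disjE exE conjE) (use x i_less_j in \<open>auto simp: mid_def\<close>)
  qed
qed

lemma distinct_sub:
  assumes "\<forall>p\<in>set c. valid p" "distinct (map key c)"
  shows "distinct (map key (concat (map sub c)))"
  using assms
proof (induction c)
  case (Cons x c)
  have "distinct (map key (sub x))"
  proof (cases "mid x")
    case True
    then have "low x" "low (flip x)" "i \<le> fst x" "fst x \<le> j" by (auto simp: mid_low mid_def)
    moreover have "valid x" using Cons.prems by simp
    moreover from this have "flip x \<noteq> x" by (auto simp: valid_def flip_def prod_eq_iff)
    ultimately have "0 < ht x" "0 < ht (flip x)" "ht (flip x) \<noteq> ht x"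
      using ht_pos ht_eq_iff[of x "flip x"] by auto
    then show ?thesis using True \<open>low x\<close> \<open>i \<le> fst x\<close> by (simp add: sub_def F_def G_def H_def)
  qed (simp add: sub_def)
  moreover have "distinct (map key (concat (map sub c)))" using Cons by simp
  moreover have "key r \<noteq> key s" if r: "r \<in> set (sub x)" and s: "s \<in> set (concat (map sub c))" for r s
  proof
    assume eq: "key r = key s"
    obtain y where y: "y \<in> set c" "s \<in> set (sub y)" using s by auto
    have val: "valid x" "valid y" using Cons.prems(1) y(1) by simp_all
    have "key r \<in> key_set y" using key_sub[OF val(2) y(2)] unfolding eq .
    with key_set_disjoint[OF val key_sub[OF val(1) r]] have xy: "key x = key y" .
    have "key x \<in> key ` set c" unfolding xy using y(1) by (rule imageI)
    moreover have "key x \<notin> key ` set c" using Cons.prems(2) by simp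
    ultimately show False by contradiction
  qed
  ultimately have "distinct (map key (sub x) @ map key (concat (map sub c)))"
    unfolding distinct_append set_map by blast
  then show ?case by simp
qed simp

lemma sub_range:
  assumes "valid x" "fst x \<in> {1..n}" "r \<in> set (sub x)"
  shows "fst r \<in> {1..n} \<and> snd r \<noteq> 0"
proof (cases "mid x")
  case True
  then have "low x" "low (flip x)" "i \<le> fst x" "fst x < j" by (auto simp: mid_low mid_def)
  then have "0 < ht x" "0 < ht (flip x)" "snd x \<noteq> 0" using ht_pos assms(1) by (auto simp: valid_def)
  then show ?thesis
    using assms(3) True \<open>low x\<close> i_pos i_less_j j_le_n \<open>fst x < j\<close> by (auto simp: sub_def F_def G_def H_def)
next
  case False
  then have r: "r = F x" using assms(3) by (simp add: sub_def)
  from assms(1) show ?thesis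
    by (cases rule: F_cases)
      (use r i_pos i_less_j j_le_n assms ht_pos[of x] ht_pos[of "flip x"] in \<open>auto simp: valid_def\<close>)
qed

lemma word_of_sub:
  assumes "valid x"
  shows "word_of (sub x) = subst (left_move i j) (word_of [x])"
proof (cases "mid x")
  case True
  then have "low x" "i \<le> fst x" "fst x < j" by (auto simp: mid_low mid_def)
  then have "0 < ht x" "0 < ht (flip x)" using ht_pos assms(1) by auto
  then show ?thesis using True \<open>low x\<close> \<open>i \<le> fst x\<close> \<open>fst x < j\<close> assms
    by (auto simp: sub_def F_def G_def H_def word_of_def subst_Cons left_move_def inv_word_def valid_def)
next
  case False
  then have s: "sub x = [F x]" by (simp add: sub_def)
  from assms show ?thesis
  proof (cases rule: F_cases)
    case low
    then have "fst x = j" "snd x < 0" "0 < ht x" using False assms ht_pos by (auto simp: mid_def low_def)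
    then show ?thesis using s low
      by (simp add: word_of_def subst_Cons left_move_def gen_def)
  next
    case up
    then have "0 < ht (flip x)" using assms ht_pos[of "flip x"] by simp
    then show ?thesis using s up
      by (simp add: word_of_def subst_Cons left_move_def gen_def inv_word_def)
  qed (use s i_less_j in \<open>auto simp: word_of_def subst_Cons left_move_def gen_def inv_word_def\<close>)
qed

lemma word_of_concat_sub:
  "\<forall>p\<in>set c. valid p \<Longrightarrow> word_of (concat (map sub c)) = subst (left_move i j) (word_of c)"
proof (induction c)
  case (Cons x c)
  have "word_of (x # c) = word_of [x] @ word_of c" by (simp add: word_of_def)
  then show ?case using Cons word_of_sub[of x] by (simp add: subst_append)
qed (simp add: word_of_def)

lemma curve_sub:
  assumes cv: "curve n c" and bd: "\<forall>p\<in>set c. \<bar>snd p\<bar> \<le> B"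
  shows "curve n (concat (map sub c))"
    and "word_of (concat (map sub c)) = subst (left_move i j) (word_of c)"
proof -
  have val: "\<forall>p\<in>set c. valid p" using cv bd by (simp add: curve_def valid_def)
  show "word_of (concat (map sub c)) = subst (left_move i j) (word_of c)"
    using word_of_concat_sub[OF val] .
  have ends: "F (0, 1) = (0, 1)" "F (Suc n, -1) = (Suc n, -1)"
    using i_pos i_less_j j_le_n by (auto simp: F_def low_def)
  have "valid a \<and> valid b" if "(a, b) \<in> set (curve_arcs n c)" for a b
  proof -
    have "valid (0, 1)" "valid (Suc n, -1)" using B_pos by (auto simp: valid_def)
    moreover have "\<forall>p\<in>flip ` set c. valid p" using val by auto
    ultimately have "\<forall>p\<in>insert (0, 1) (flip ` set c). valid p" "\<forall>p\<in>insert (Suc n, -1) (set c). valid p"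
      using val by blast+
    then show ?thesis using arcs_points[OF that] by blast
  qed
  then have "noncrossing (map_prod F F ` set (curve_arcs n c) \<union> gap_arcs)"
    by (rule noncrossing_sub[OF curve_noncrossing[OF cv]])
  moreover have "set (curve_arcs n (concat (map sub c))) \<subseteq> map_prod F F ` set (curve_arcs n c) \<union> gap_arcs"
    using arcs_sub[OF val ends(2), of "(0, 1)"] unfolding ends(1) .
  ultimately have "noncrossing (set (curve_arcs n (concat (map sub c))))"
    by (rule noncrossing_mono)
  moreover have "\<forall>p\<in>set (concat (map sub c)). fst p \<in> {1..n} \<and> snd p \<noteq> 0"
  proof
    fix p assume "p \<in> set (concat (map sub c))"
    then obtain x where x: "x \<in> set c" "p \<in> set (sub x)" by auto
    then show "fst p \<in> {1..n} \<and> snd p \<noteq> 0"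
      using curve_range[OF cv] val by (intro sub_range[of x p]) blast+
  qed
  moreover have "distinct (map key (concat (map sub c)))"
    using distinct_sub val cv unfolding curve_def by blast
  ultimately show "curve n (concat (map sub c))" unfolding curve_def by blast
qed

end

lemma curve_left_move:
  assumes "curve n c" "1 \<le> i" "i < j" "j \<le> n"
  obtains c' where "curve n c'" "word_of c' = ext (left_move i j) (word_of c)"
proof -
  \<comment> \<open>Inserting 1 takes care of the empty curve and of the base point, whose two
    copies have height 1.\<close>
  define B where "B = Max (insert 1 ((\<lambda>p. \<bar>snd p\<bar>) ` set c))"
  have "1 \<le> B" "\<forall>p\<in>set c. \<bar>snd p\<bar> \<le> B" by (auto simp: B_def intro: Max_ge)
  then interpret left_shift i j n B using assms by unfold_locales auto
  have "curve n (concat (map sub c))" using curve_sub(1) assms(1) \<open>\<forall>p\<in>set c. \<bar>snd p\<bar> \<le> B\<close> by blast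
  then obtain c' where "curve n c'" "word_of c' = reduce (word_of (concat (map sub c)))"
    using curve_reduce by blast
  then show ?thesis
    using that curve_sub(2)[OF assms(1)] \<open>\<forall>p\<in>set c. \<bar>snd p\<bar> \<le> B\<close> by (simp add: ext_eq)
qed

context left_shift
begin

text \<open>
  \<open>tight\<close> is the image of the curve's word with the cancellations \<open>t\<^sub>i\<^sup>-\<^sup>1 t\<^sub>i\<close> along chords
  inside the low region carried out: a crossing with the new ray is recorded only when
  a chord changes between low and not low.
\<close>

definition rho :: "bool \<Rightarrow> word" where
  "rho s = (if s then [(i, False)] else [])"

definition step :: "bool \<Rightarrow> bool \<Rightarrow> word" where
  "step s q = (if s = q then [] else [(i, s)])"

definition new_letter :: "point \<Rightarrow> word" where
  "new_letter x = (if fst x = j then [] else [(if mid x then Suc (fst x) else fst x, 0 < snd x)])"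

fun tight :: "bool \<Rightarrow> point list \<Rightarrow> word" where
  "tight s [] = step s False"
| "tight s (x # c) = step s (low x) @ new_letter x @ tight (low (flip x)) c"

lemma rho_step: "rho s @ step s q \<approx> rho q"
  by (auto simp: rho_def step_def feq_def reduce_def)

lemma rho_letter:
  assumes "snd x \<noteq> 0"
  shows "rho (low x) @ new_letter x \<approx> subst (left_move i j) (word_of [x]) @ rho (low (flip x))"
proof -
  consider "mid x" | "fst x = j" "snd x < 0" | "fst x = j" "0 < snd x" | "fst x < i \<or> j < fst x"
    using assms unfolding mid_def by linarith
  then show ?thesis
  proof cases
    case 1
    then have "low x" "low (flip x)" "i \<le> fst x" "fst x < j" by (auto simp: mid_low mid_def)
    then show ?thesis using 1
      by (auto simp: rho_def new_letter_def word_of_def subst_Cons left_move_def inv_word_def feq_def reduce_def)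
  next
    case 2
    then show ?thesis
      by (simp add: rho_def new_letter_def low_def word_of_def subst_Cons left_move_def gen_def)
  next
    case 3
    then show ?thesis
      by (simp add: rho_def new_letter_def low_def word_of_def subst_Cons left_move_def gen_def inv_word_def
          feq_def reduce_def)
  next
    case 4
    then have "\<not> mid x" "fst x \<noteq> j" "\<not> low x" "\<not> low (flip x)" using i_less_j by (auto simp: mid_def low_def)
    then show ?thesis using 4
      by (auto simp: rho_def new_letter_def word_of_def subst_Cons left_move_def gen_def inv_word_def)
  qed
qed

text \<open>In the substituted word every crossing is made from outside the low region, so a start
  inside it costs an extra \<open>t_i\<close>. The factor \<open>rho s\<close> records this debt,
  and \<open>rho_letter\<close> hands it on from crossing to crossing.\<close>

lemma tight_feq:
  "\<forall>x\<in>set c. snd x \<noteq> 0 \<Longrightarrow> rho s @ tight s c \<approx> subst (left_move i j) (word_of c)"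
proof (induction c arbitrary: s)
  case Nil
  then show ?case using rho_step[of s False] by (simp add: word_of_def rho_def)
next
  case (Cons x c)
  let ?S = "subst (left_move i j)"
  have x: "snd x \<noteq> 0" using Cons.prems by simp
  have "rho s @ tight s (x # c) = (rho s @ step s (low x)) @ new_letter x @ tight (low (flip x)) c" by simp
  also have "\<dots> \<approx> rho (low x) @ new_letter x @ tight (low (flip x)) c"
    by (intro feq_append rho_step feq_refl)
  also have "\<dots> = (rho (low x) @ new_letter x) @ tight (low (flip x)) c" by simp
  also have "\<dots> \<approx> (?S (word_of [x]) @ rho (low (flip x))) @ tight (low (flip x)) c"
    by (intro feq_append rho_letter[OF x] feq_refl)
  also have "\<dots> = ?S (word_of [x]) @ rho (low (flip x)) @ tight (low (flip x)) c" by simp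
  also have "\<dots> \<approx> ?S (word_of [x]) @ ?S (word_of c)"
    using Cons by (intro feq_append) auto
  also have "\<dots> = ?S (word_of (x # c))" by (simp add: word_of_def subst_append[symmetric])
  finally show ?case .
qed

abbreviation crossing :: "point \<times> point \<Rightarrow> bool" where
  "crossing r \<equiv> low (fst r) \<noteq> low (snd r)"

abbreviation inside :: "point \<times> point \<Rightarrow> bool" where
  "inside r \<equiv> low (fst r) \<and> low (snd r)"

lemma length_tight:
  "\<not> low E \<Longrightarrow> length (tight (low P) c)
     = length (filter crossing (arcs P c E)) + length (filter (\<lambda>x. fst x \<noteq> j) c)"
  by (induction c arbitrary: P) (auto simp: step_def new_letter_def)

text \<open>A double count of the low ends of chords: grouped by crossings, one of a middle ray
  supplies both of its sides and one of \<open>r_j\<close> only the left side; the start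
  \<open>P\<close> is counted separately.\<close>

lemma count_low_ends:
  assumes "\<forall>x\<in>set c. snd x \<noteq> 0" "\<not> low E"
  shows "length (filter crossing (arcs P c E)) + 2 * length (filter inside (arcs P c E))
    = (if low P then 1 else 0) + 2 * length (filter mid c) + length (filter (\<lambda>x. fst x = j) c)"
  using assms(1)
proof (induction c arbitrary: P)
  case Nil
  then show ?case using assms(2) by simp
next
  case (Cons x c)
  have x: "snd x \<noteq> 0" using Cons.prems by simp
  have IH: "length (filter crossing (arcs (flip x) c E)) + 2 * length (filter inside (arcs (flip x) c E))
    = (if low (flip x) then 1 else 0) + 2 * length (filter mid c) + length (filter (\<lambda>x. fst x = j) c)"
    using Cons by simp
  have "(if low (flip x) then 1 else 0) + (if low x then 1 else 0)
      = (if mid x then 2 else 0) + (if fst x = j then 1 else (0::nat))"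
    using x unfolding low_def mid_def by auto
  then show ?case using IH by (simp split: if_splits)
qed

text \<open>By the double count, the tightened word differs in length from the old one by twice the
  number of middle crossings minus twice the number of chords inside the low region.\<close>

lemma length_ext_left_move:
  assumes c: "curve n c"
    and more: "length (filter mid c) < length (filter inside (curve_arcs n c))"
  shows "length (ext (left_move i j) (word_of c)) < length c"
proof -
  have nz: "\<forall>x\<in>set c. snd x \<noteq> 0" using curve_range[OF c] by blast
  have ends: "\<not> low (0, 1)" "\<not> low (Suc n, -1)" using i_pos j_le_n by (auto simp: low_def)
  have "length (ext (left_move i j) (word_of c)) = length (reduce (tight False c))"
    using tight_feq[OF nz, of False] by (simp add: ext_eq feq_def rho_def)
  also have "\<dots> \<le> length (tight (low (0, 1)) c)" using length_reduce_le ends by simp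
  also have "\<dots> = length (filter crossing (curve_arcs n c)) + length (filter (\<lambda>x. fst x \<noteq> j) c)"
    by (rule length_tight[OF ends(2)])
  also have "\<dots> < length c"
    using count_low_ends[OF nz ends(2), of "(0, 1)"] ends(1) more
      sum_length_filter_compl[of "\<lambda>x. fst x = j" c] by simp
  finally show ?thesis .
qed

end

section \<open>Shortening along a chord between left sides\<close>

definition arc_pair :: "nat \<Rightarrow> point list \<Rightarrow> nat \<Rightarrow> point \<times> point" where
  "arc_pair n c k = curve_arcs n c ! k"

lemma arc_pair_mem: "k \<le> length c \<Longrightarrow> arc_pair n c k \<in> set (curve_arcs n c)"
  by (simp add: arc_pair_def)

lemma fst_arc_pair_Suc: "k < length c \<Longrightarrow> fst (arc_pair n c (Suc k)) = flip (c ! k)"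
  by (simp add: arc_pair_def nth_arcs)

lemma fst_arc_pair_0: "fst (arc_pair n c 0) = (0, 1)"
  by (simp add: arc_pair_def nth_arcs)

lemma snd_arc_pair: "k < length c \<Longrightarrow> snd (arc_pair n c k) = c ! k"
  by (simp add: arc_pair_def nth_arcs nth_append)

lemma snd_arc_pair_length: "snd (arc_pair n c (length c)) = (Suc n, -1)"
  by (simp add: arc_pair_def nth_arcs)

lemma shorten_lower_arc:
  assumes c: "curve n c" and ab: "(a, b) \<in> set (curve_arcs n c)"
    and neg: "snd a < 0" "snd b < 0" and ne: "fst a \<noteq> fst b" "fst b \<le> n"
    and none: "\<And>p q. (p, q) \<in> set (curve_arcs n c) \<Longrightarrow> btw a b p \<Longrightarrow> \<not> (0 < snd p \<and> 0 < snd q)"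
  obtains i j where "1 \<le> i" "i < j" "j \<le> n" "length (ext (left_move i j) (word_of c)) < length c"
proof -
  define i where "i = min (fst a) (fst b)"
  define j where "j = max (fst a) (fst b)"
  obtain k0 where k0: "k0 \<le> length c" "(a, b) = arc_pair n c k0"
    using ab unfolding in_set_conv_nth arc_pair_def by (auto simp: less_Suc_eq_le)
  have rng: "1 \<le> fst x" "fst x \<le> n" "snd x \<noteq> 0" if "x \<in> set c" for x
    using curve_range[OF c that] by auto
  have a: "a \<in> flip ` set c" and b: "b \<in> set c"
    using arcs_points[OF ab] neg ne(2) by auto
  have ij: "1 \<le> i" "i < j" "j \<le> n"
  proof -
    have "1 \<le> fst a" "fst a \<le> n" "1 \<le> fst b" using a b rng by auto
    then show "1 \<le> i" "i < j" "j \<le> n" using ne unfolding i_def j_def by linarith+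
  qed
  \<comment> \<open>The counts of low ends do not involve heights, so the least admissible bound is
    taken.\<close>
  interpret left_shift i j n 1 using ij by unfold_locales auto
  have cs: "fst a < fst b \<and> i = fst a \<and> j = fst b \<or> fst b < fst a \<and> i = fst b \<and> j = fst a"
    using ne(1) unfolding i_def j_def by linarith
  have low_btw: "low p" if "btw a b p" for p
    using cs that neg unfolding btw_iff point_less_iff low_def by presburger
  have low_ends: "low a" "low b"
    using cs neg unfolding low_def by presburger+
  have mid_btw: "btw a b p" if "mid p" "0 < snd p" for p
    using cs that neg unfolding btw_iff point_less_iff mid_def by presburger
  \<comment> \<open>The chord that ends at the right side of crossing \<open>k\<close>: the arriving
    one if the ray is crossed from the right, otherwise the leaving one.\<close>
  define \<alpha> where "\<alpha> k = (if 0 < snd (c ! k) then k else Suc k)" for k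
  let ?M = "{k. k < length c \<and> mid (c ! k)}"
  let ?I = "{k. k < Suc (length c) \<and> inside (curve_arcs n c ! k)}"
  have nc: "noncrossing (set (curve_arcs n c))" using curve_noncrossing[OF c] .
  have \<alpha>: "\<alpha> k \<le> length c \<and> \<alpha> k \<noteq> k0
      \<and> btw a b (fst (arc_pair n c (\<alpha> k))) \<and> btw a b (snd (arc_pair n c (\<alpha> k)))"
    if k: "k \<in> ?M" for k
  proof -
    have kl: "k < length c" "mid (c ! k)" using k by auto
    have nz: "snd (c ! k) \<noteq> 0" using rng kl by simp
    have le: "\<alpha> k \<le> length c" using kl by (simp add: \<alpha>_def)
    have arc: "(fst (arc_pair n c (\<alpha> k)), snd (arc_pair n c (\<alpha> k))) \<in> set (curve_arcs n c)"
      using arc_pair_mem[OF le] by simp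
    have or: "btw a b (fst (arc_pair n c (\<alpha> k))) \<or> btw a b (snd (arc_pair n c (\<alpha> k)))"
    proof (cases "0 < snd (c ! k)")
      case True
      then show ?thesis using mid_btw[of "c ! k"] kl by (simp add: \<alpha>_def snd_arc_pair)
    next
      case False
      then show ?thesis using mid_btw[of "flip (c ! k)"] kl nz by (simp add: \<alpha>_def fst_arc_pair_Suc)
    qed
    then have both: "btw a b (fst (arc_pair n c (\<alpha> k))) \<and> btw a b (snd (arc_pair n c (\<alpha> k)))"
      using noncrossingD[OF nc ab arc] by blast
    moreover have "\<alpha> k \<noteq> k0" using both k0(2) not_btw_self(1)[of a b] by (metis fst_conv)
    ultimately show ?thesis using le by blast
  qed
  have inj: "inj_on \<alpha> ?M"
  proof -
    \<comment> \<open>Two crossings can share such a chord only if it joins two right sides, which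
      \<open>none\<close> rules out below \<open>(a, b)\<close>.\<close>
    have no: "\<alpha> k \<noteq> \<alpha> k'" if k: "k \<in> ?M" "k' \<in> ?M" "k < k'" for k k'
    proof
      assume eq: "\<alpha> k = \<alpha> k'"
      then have "k' = Suc k" "\<not> 0 < snd (c ! k)" "0 < snd (c ! k')"
        using k(3) by (auto simp: \<alpha>_def split: if_splits)
      then have "\<alpha> k = Suc k" "0 < snd (flip (c ! k))" "0 < snd (c ! Suc k)"
        using rng[of "c ! k"] k(1) by (auto simp: \<alpha>_def)
      moreover have "Suc k < length c" using k(2) \<open>k' = Suc k\<close> by simp
      ultimately have "btw a b (flip (c ! k))" "(flip (c ! k), c ! Suc k) \<in> set (curve_arcs n c)"
        using \<alpha>[OF k(1)] fst_arc_pair_Suc[of k c n] snd_arc_pair[of "Suc k" c n] arc_pair_mem[of "Suc k" c n]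
        by (simp_all) (metis prod.collapse)
      then show False using none \<open>0 < snd (flip (c ! k))\<close> \<open>0 < snd (c ! Suc k)\<close> by blast
    qed
    show ?thesis
    proof (rule inj_onI, rule ccontr)
      fix k k' assume "k \<in> ?M" "k' \<in> ?M" "\<alpha> k = \<alpha> k'" "k \<noteq> k'"
      then show False using no[of k k'] no[of k' k] by (metis linorder_neqE_nat)
    qed
  qed
  \<comment> \<open>The chord \<open>(a, b)\<close> is inside the low region too and is never chosen
    by \<open>\<alpha>\<close>, since \<open>a\<close> is not strictly below it. This extra chord
    makes the inequality strict.\<close>
  have "curve_arcs n c ! k0 = (a, b)" using k0(2) by (simp add: arc_pair_def)
  then have "k0 \<in> ?I" using low_ends k0(1) by simp
  moreover have "\<alpha> k \<in> ?I" if "k \<in> ?M" for k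
    using \<alpha>[OF that] low_btw unfolding arc_pair_def by (simp add: less_Suc_eq_le)
  ultimately have "insert k0 (\<alpha> ` ?M) \<subseteq> ?I" by blast
  moreover have "k0 \<notin> \<alpha> ` ?M" using \<alpha> by blast
  moreover have "finite ?M" "finite ?I" by auto
  ultimately have "Suc (card ?M) \<le> card ?I"
    using card_mono[of ?I "insert k0 (\<alpha> ` ?M)"] card_image[OF inj] by simp
  then have "length (filter mid c) < length (filter inside (curve_arcs n c))"
    unfolding length_filter_conv_card by simp
  then show ?thesis using length_ext_left_move[OF c] that[OF ij] by blast
qed

section \<open>Reflection\<close>

definition mirror_point :: "nat \<Rightarrow> point \<Rightarrow> point" where
  "mirror_point n p = (Suc n - fst p, - snd p)"

text \<open>Reflection exchanges the sides of a ray, and traversing backwards exchanges arrival and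
  departure. The two changes of sign cancel, so \<open>snd p\<close> stays.\<close>

definition mirror_curve :: "nat \<Rightarrow> point list \<Rightarrow> point list" where
  "mirror_curve n c = rev (map (\<lambda>p. (Suc n - fst p, snd p)) c)"

lemma mirror_point_less:
  "fst p \<le> Suc n \<Longrightarrow> fst q \<le> Suc n \<Longrightarrow> mirror_point n p < mirror_point n q \<longleftrightarrow> q < p"
  by (auto simp: mirror_point_def point_less_iff)

lemma btw_mirror_point:
  assumes "fst p \<le> Suc n" "fst q \<le> Suc n" "fst r \<le> Suc n"
  shows "btw (mirror_point n q) (mirror_point n p) (mirror_point n r) \<longleftrightarrow> btw p q r"
  using assms unfolding btw_iff by (auto simp: mirror_point_less)

lemma arcs_snoc: "arcs P (c @ [x]) E = arcs P c x @ [(flip x, E)]"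
  by (simp add: arcs_append)

lemma arcs_mirror:
  "arcs (mirror_point n E) (mirror_curve n c) (mirror_point n P)
    = rev (map (\<lambda>r. (mirror_point n (snd r), mirror_point n (fst r))) (arcs P c E))"
proof (induction c arbitrary: P)
  case (Cons x c)
  have "arcs (mirror_point n E) (mirror_curve n (x # c)) (mirror_point n P)
      = arcs (mirror_point n E) (mirror_curve n c) (mirror_point n (flip x)) @ [(mirror_point n x, mirror_point n P)]"
    by (simp add: mirror_curve_def arcs_snoc mirror_point_def)
  then show ?case using Cons by simp
qed (simp add: mirror_curve_def)

lemma set_arcs_mirror:
  "set (curve_arcs n (mirror_curve n c)) = (\<lambda>r. (mirror_point n (snd r), mirror_point n (fst r))) ` set (curve_arcs n c)"
  using arcs_mirror[of n "(Suc n, -1)" c "(0, 1)"] by (simp add: mirror_point_def)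

lemma curve_arcs_le:
  assumes "curve n c" "(a, b) \<in> set (curve_arcs n c)"
  shows "fst a \<le> n \<and> fst b \<le> Suc n"
proof -
  have "fst p \<le> n" if "p \<in> set c" for p using curve_range[OF assms(1) that] by simp
  then have "\<forall>p\<in>insert (0, 1) (flip ` set c). fst p \<le> n" "\<forall>p\<in>insert (Suc n, -1) (set c). fst p \<le> Suc n"
    by (auto simp: le_SucI)
  then show ?thesis using arcs_points[OF assms(2)] by blast
qed

lemma curve_mirror:
  assumes "curve n c"
  shows "curve n (mirror_curve n c)"
proof -
  have "\<forall>p\<in>set (mirror_curve n c). fst p \<in> {1..n} \<and> snd p \<noteq> 0"
  proof
    fix p assume "p \<in> set (mirror_curve n c)"
    then obtain q where "q \<in> set c" "p = (Suc n - fst q, snd q)" by (auto simp: mirror_curve_def)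
    then show "fst p \<in> {1..n} \<and> snd p \<noteq> 0" using curve_range[OF assms, of q] by auto
  qed
  moreover have "distinct (map (\<lambda>p. (fst p, \<bar>snd p\<bar>)) (mirror_curve n c))"
  proof -
    have d: "distinct c" "inj_on (\<lambda>p. (fst p, \<bar>snd p\<bar>)) (set c)"
      using assms unfolding curve_def distinct_map by blast+
    have "inj_on (\<lambda>p. (Suc n - fst p, \<bar>snd p\<bar>)) (set c)"
    proof (rule inj_onI)
      fix p q assume pq: "p \<in> set c" "q \<in> set c" "(Suc n - fst p, \<bar>snd p\<bar>) = (Suc n - fst q, \<bar>snd q\<bar>)"
      then have "fst p = fst q" using curve_range[OF assms, of p] curve_range[OF assms, of q] by auto
      then show "p = q" using inj_onD[OF d(2), of p q] pq by simp
    qed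
    then show ?thesis using d(1) by (simp add: mirror_curve_def distinct_map o_def rev_map[symmetric])
  qed
  moreover have "noncrossing (set (curve_arcs n (mirror_curve n c)))"
    unfolding noncrossing_def set_arcs_mirror
  proof (intro ballI, elim imageE)
    fix x y r s
    assume xy: "x = (mirror_point n (snd r), mirror_point n (fst r))" "r \<in> set (curve_arcs n c)"
      "y = (mirror_point n (snd s), mirror_point n (fst s))" "s \<in> set (curve_arcs n c)"
    have le: "fst (fst r) \<le> Suc n" "fst (snd r) \<le> Suc n" "fst (fst s) \<le> Suc n" "fst (snd s) \<le> Suc n"
      using curve_arcs_le[OF assms, of "fst r" "snd r"] curve_arcs_le[OF assms, of "fst s" "snd s"] xy(2,4)
      by auto
    have "btw (fst r) (snd r) (fst s) = btw (fst r) (snd r) (snd s)"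
      using noncrossingD[OF curve_noncrossing[OF assms], of "fst r" "snd r" "fst s" "snd s"] xy(2,4) by simp
    then show "btw (fst x) (snd x) (fst y) = btw (fst x) (snd x) (snd y)"
      unfolding xy fst_conv snd_conv using btw_mirror_point[OF le(1,2,3)] btw_mirror_point[OF le(1,2,4)]
      by simp
  qed
  ultimately show ?thesis unfolding curve_def by blast
qed

lemma word_of_mirror_curve: "word_of (mirror_curve n c) = mirror n (word_of c)"
  by (simp add: mirror_curve_def word_of_def mirror_def rev_map o_def)

lemma over_word_of: "curve n c \<Longrightarrow> over n (word_of c)"
  using curve_range[of n c] by (auto simp: over_def word_of_def)

lemma shorten_upper_arc:
  assumes c: "curve n c" and ab: "(a, b) \<in> set (curve_arcs n c)"
    and pos: "0 < snd a" "0 < snd b" and ne: "fst a \<noteq> fst b" "1 \<le> fst a"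
    and none: "\<And>p q. (p, q) \<in> set (curve_arcs n c) \<Longrightarrow> btw a b p \<Longrightarrow> \<not> (snd p < 0 \<and> snd q < 0)"
  obtains i j where "1 \<le> i" "i < j" "j \<le> n"
    "length (ext (left_move i j) (word_of (mirror_curve n c))) < length c"
proof -
  let ?\<mu> = "mirror_point n"
  have le: "fst a \<le> Suc n" "fst b \<le> Suc n" using curve_arcs_le[OF c ab] by auto
  have arc: "(?\<mu> b, ?\<mu> a) \<in> set (curve_arcs n (mirror_curve n c))"
    unfolding set_arcs_mirror using ab by force
  have signs: "snd (?\<mu> b) < 0" "snd (?\<mu> a) < 0" "fst (?\<mu> b) \<noteq> fst (?\<mu> a)" "fst (?\<mu> a) \<le> n"
    using pos ne le by (auto simp: mirror_point_def)
  have no: "\<not> (0 < snd p \<and> 0 < snd q)"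
    if pq: "(p, q) \<in> set (curve_arcs n (mirror_curve n c))" "btw (?\<mu> b) (?\<mu> a) p" for p q
  proof -
    obtain r where r: "r \<in> set (curve_arcs n c)" "p = ?\<mu> (snd r)" "q = ?\<mu> (fst r)"
      using pq(1) unfolding set_arcs_mirror by auto
    \<comment> \<open>The reflected chord is traversed backwards, so the assumption speaks about
      \<open>snd r\<close> and has to be moved to \<open>fst r\<close> by noncrossing.\<close>
    have "btw a b (snd r)"
      using pq(2) btw_mirror_point[OF le, of "snd r"] curve_arcs_le[OF c, of "fst r" "snd r"] r(1,2) by simp
    then have "btw a b (fst r)"
      using noncrossingD[OF curve_noncrossing[OF c] ab, of "fst r" "snd r"] r(1) by simp
    then show ?thesis using none[of "fst r" "snd r"] r by (auto simp: mirror_point_def)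
  qed
  obtain i j where "1 \<le> i" "i < j" "j \<le> n"
    "length (ext (left_move i j) (word_of (mirror_curve n c))) < length (mirror_curve n c)"
    using shorten_lower_arc[OF curve_mirror[OF c] arc signs no] by blast
  then show ?thesis using that by (simp add: mirror_curve_def)
qed

section \<open>Innermost chords between equal sides\<close>

definition lower_arc :: "nat \<Rightarrow> point \<times> point \<Rightarrow> bool" where
  "lower_arc n r \<longleftrightarrow> snd (fst r) < 0 \<and> snd (snd r) < 0 \<and> fst (snd r) \<le> n"

text \<open>The bounds here and in \<open>lower_arc\<close> exclude chords at the base point, whose
  two copies carry signs that do not stand for sides of rays.\<close>

definition upper_arc :: "point \<times> point \<Rightarrow> bool" where
  "upper_arc r \<longleftrightarrow> 0 < snd (fst r) \<and> 0 < snd (snd r) \<and> 1 \<le> fst (fst r)"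

text \<open>Such a chord between equal sides of one ray would come from a letter followed by its
  inverse.\<close>

lemma reduced_arc_fst_neq:
  assumes c: "curve n c" and red: "reduced (word_of c)" and ab: "(a, b) \<in> set (curve_arcs n c)"
    and sgn: "lower_arc n (a, b) \<or> upper_arc (a, b)"
  shows "fst a \<noteq> fst b"
proof
  assume eq: "fst a = fst b"
  obtain k where k: "k \<le> length c" "(a, b) = arc_pair n c k"
    using ab unfolding in_set_conv_nth arc_pair_def by (auto simp: less_Suc_eq_le)
  then have ab': "a = fst (arc_pair n c k)" "b = snd (arc_pair n c k)" by (metis fst_conv snd_conv)+
  have "k \<noteq> 0"
  proof
    assume "k = 0"
    then have "a = (0, 1)" using ab'(1) by (simp add: fst_arc_pair_0)
    then show False using sgn by (simp add: lower_arc_def upper_arc_def)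
  qed
  then obtain k' where k': "k = Suc k'" by (cases k) auto
  have "k \<noteq> length c"
  proof
    assume "k = length c"
    then have "b = (Suc n, -1)" using ab'(2) by (simp add: snd_arc_pair_length)
    then show False using sgn by (simp add: lower_arc_def upper_arc_def)
  qed
  then have kl: "Suc k' < length c" using k k' by simp
  then have p: "a = flip (c ! k')" "b = c ! Suc k'"
    using ab' k' fst_arc_pair_Suc[of k' c n] snd_arc_pair[of "Suc k'" c n] by simp_all
  have nz: "snd (c ! k') \<noteq> 0" using curve_range[OF c] kl by simp
  have "c = take k' c @ c ! k' # c ! Suc k' # drop (Suc (Suc k')) c"
    using kl by (simp add: Cons_nth_drop_Suc)
  then have w: "word_of c = word_of (take k' c) @ word_of [c ! k', c ! Suc k'] @ word_of (drop (Suc (Suc k')) c)"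
    by (metis append_Cons append_Nil word_of_append)
  have "reduced (word_of [c ! k', c ! Suc k'])"
    using red unfolding w by (simp only: reduced_append)
  then show False using eq sgn p nz by (auto simp: word_of_def lower_arc_def upper_arc_def)
qed

lemma btw_trans:
  assumes "btw a b p" "btw a b q" "btw p q x"
  shows "btw a b x"
proof -
  have "min a b < min p q" "max p q < max a b" using assms(1,2) unfolding btw_def by simp_all
  then show ?thesis using assms(3) unfolding btw_def by (meson less_trans)
qed

text \<open>A minimal number of chords below makes the chosen chord innermost for both kinds at
  once, so the opposite kind does not occur below it either. For an upper arc the braid is found on
  the reflected curve and conjugated back.\<close>

lemma curve_shorten:
  assumes c: "curve n c" and red: "reduced (word_of c)"
    and ex: "\<exists>r\<in>set (curve_arcs n c). lower_arc n r \<or> upper_arc r"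
  obtains f g c' where "braid_pair n f g" "curve n c'" "word_of c' = ext f (word_of c)" "length c' < length c"
proof -
  define A where "A = set (curve_arcs n c)"
  define P where "P r \<longleftrightarrow> r \<in> A \<and> (lower_arc n r \<or> upper_arc r)" for r
  define ins where "ins r = {s \<in> A. btw (fst r) (snd r) (fst s)}" for r
  obtain r0 where "P r0" using ex unfolding P_def A_def by blast
  then obtain r where r: "P r" "\<And>s. P s \<Longrightarrow> card (ins r) \<le> card (ins s)"
    using arg_min_natI[of P r0 "\<lambda>r. card (ins r)"] arg_min_nat_le[of P _ "\<lambda>r. card (ins r)"] by blast
  obtain a b where ab: "r = (a, b)" by (cases r) auto
  have rA: "(a, b) \<in> set (curve_arcs n c)" using r ab by (simp add: P_def A_def)
  have fin: "finite (ins s)" for s by (simp add: ins_def A_def)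
  have nc: "noncrossing A" unfolding A_def by (rule curve_noncrossing[OF c])
  have none: "\<not> P s" if s: "s \<in> A" "btw a b (fst s)" for s
  proof
    assume "P s"
    have s2: "btw a b (snd s)"
      using noncrossingD[OF nc, of a b "fst s" "snd s"] s rA by (simp add: A_def)
    have "ins s \<subseteq> ins r"
    proof
      fix x assume "x \<in> ins s"
      then have x: "x \<in> A" "btw (fst s) (snd s) (fst x)" by (auto simp: ins_def)
      have "btw a b (fst x)" using btw_trans[OF s(2) s2 x(2)] .
      then show "x \<in> ins r" using x(1) by (simp add: ins_def ab)
    qed
    moreover have "s \<in> ins r" "s \<notin> ins s" using s by (auto simp: ins_def ab)
    ultimately have "card (ins s) < card (ins r)" by (intro psubset_card_mono fin) blast
    then show False using r(2)[OF \<open>P s\<close>] by simp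
  qed
  have sgn: "lower_arc n (a, b) \<or> upper_arc (a, b)" using r(1) ab by (simp add: P_def)
  have ne: "fst a \<noteq> fst b" using reduced_arc_fst_neq[OF c red rA sgn] .
  \<comment> \<open>A chord below \<open>(a, b)\<close> avoids the base point, so equal signs at its
    ends already make it a lower or an upper arc.\<close>
  have inner: "fst (fst s) \<noteq> 0 \<and> fst (snd s) \<le> n" if s: "s \<in> A" "btw a b (fst s)" for s
  proof -
    have s2: "btw a b (snd s)"
      using noncrossingD[OF nc, of a b "fst s" "snd s"] s rA by (simp add: A_def)
    have "flip a \<in> set c" "b \<in> set c"
      using sgn arcs_points[OF rA] by (auto simp: lower_arc_def upper_arc_def)
    then have "1 \<le> fst a" "fst a \<le> n" "1 \<le> fst b" "fst b \<le> n"
      using curve_range[OF c, of "flip a"] curve_range[OF c, of b] by simp_all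
    then show ?thesis using s(2) s2 unfolding btw_iff point_less_iff by presburger
  qed
  from sgn show thesis
  proof
    assume low: "lower_arc n (a, b)"
    have "\<not> (0 < snd p \<and> 0 < snd q)" if "(p, q) \<in> set (curve_arcs n c)" "btw a b p" for p q
      using none[of "(p, q)"] inner[of "(p, q)"] that unfolding P_def A_def upper_arc_def by auto
    then obtain i j where ij: "1 \<le> i" "i < j" "j \<le> n" "length (ext (left_move i j) (word_of c)) < length c"
      using shorten_lower_arc[OF c rA _ _ ne] low by (metis fst_conv lower_arc_def snd_conv)
    obtain c' where c': "curve n c'" "word_of c' = ext (left_move i j) (word_of c)"
      using curve_left_move[OF c ij(1-3)] .
    have "length c' < length c" using ij(4) unfolding c'(2)[symmetric] by simp
    then show thesis using that braid_pair_left_move[OF ij(1-3)] c' by blast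
  next
    assume up: "upper_arc (a, b)"
    have "\<not> (snd p < 0 \<and> snd q < 0)" if "(p, q) \<in> set (curve_arcs n c)" "btw a b p" for p q
      using none[of "(p, q)"] inner[of "(p, q)"] that unfolding P_def A_def lower_arc_def by auto
    then obtain i j where ij: "1 \<le> i" "i < j" "j \<le> n"
      "length (ext (left_move i j) (word_of (mirror_curve n c))) < length c"
      using shorten_upper_arc[OF c rA _ _ ne] up by (metis fst_conv upper_arc_def snd_conv)
    obtain c' where c': "curve n c'" "word_of c' = ext (left_move i j) (word_of (mirror_curve n c))"
      using curve_left_move[OF curve_mirror[OF c] ij(1-3)] .
    have bp: "braid_pair n (left_move i j) (right_move i j)" using braid_pair_left_move[OF ij(1-3)] .
    have "word_of (mirror_curve n c') = ext (mirror_map n (left_move i j)) (word_of c)"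
      unfolding word_of_mirror_curve c'(2)
      using bp over_word_of[OF c] by (subst ext_mirror_map) (auto simp: braid_pair_def braid_map_def)
    moreover have "length (mirror_curve n c') < length c"
      using ij(4) unfolding c'(2)[symmetric] by (simp add: mirror_curve_def)
    ultimately show thesis using that braid_pair_mirror_map[OF bp] curve_mirror[OF c'(1)] by blast
  qed
qed

section \<open>Curves of constant sign\<close>

lemma curve_distinct: "curve n c \<Longrightarrow> distinct c"
  unfolding curve_def distinct_map by blast

lemma curve_arcs_ends_le:
  assumes c: "curve n c" and ab: "(a, b) \<in> set (curve_arcs n c)"
  shows "(0, 1) \<le> a \<and> a < (Suc n, -1) \<and> (0, 1) < b \<and> b \<le> (Suc n, -1)"
proof -
  have "(0, 1) < x \<and> x < (Suc n, -1)" if "fst x \<in> {1..n}" for x :: point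
    using that by (auto simp: point_less_iff)
  then have "\<forall>x\<in>flip ` set c. (0, 1) < x \<and> x < (Suc n, -1)" "\<forall>x\<in>set c. (0, 1) < x \<and> x < (Suc n, -1)"
    using curve_range[OF c] by (metis fst_flip imageE)+
  moreover have "(0, 1) < (Suc n, - 1 :: int)" by (simp add: point_less_iff)
  ultimately show ?thesis using arcs_points[OF ab] by (metis insertE order.strict_implies_order order_refl)
qed

text \<open>Each chord has both or none of its ends below the given one, and the base point is never
  below it. Counting the ends of chords gives the crossings, counting their starts gives the
  flips.\<close>

lemma curve_arc_balance:
  assumes c: "curve n c" and ab: "(a, b) \<in> set (curve_arcs n c)"
  shows "(\<Sum>x\<in>set c. of_bool (btw a b x)) = (\<Sum>x\<in>set c. of_bool (btw a b (flip x)) :: int)"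
proof -
  have cnt: "int (length (filter p c)) = (\<Sum>x\<in>set c. of_bool (p x))" for p
    using curve_distinct[OF c] by (induction c) auto
  let ?A = "curve_arcs n c"
  have "filter (\<lambda>r. btw a b (fst r)) ?A = filter (\<lambda>r. btw a b (snd r)) ?A"
    using noncrossingD[OF curve_noncrossing[OF c] ab] by (intro filter_cong refl) (metis prod.collapse)
  then have "length (filter (btw a b) (map fst ?A)) = length (filter (btw a b) (map snd ?A))"
    by (simp add: filter_map o_def)
  moreover have "\<not> btw a b (0, 1)" "\<not> btw a b (Suc n, -1)"
    using curve_arcs_ends_le[OF c ab] unfolding btw_iff by auto
  ultimately have "length (filter (btw a b) (map flip c)) = length (filter (btw a b) c)"
    unfolding map_fst_arcs map_snd_arcs by simp
  then show ?thesis using cnt[of "btw a b"] cnt[of "\<lambda>x. btw a b (flip x)"] by (simp add: filter_map o_def)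
qed

section \<open>Curves of positive letters\<close>

lemma arc_pair_mem': "k \<le> length c \<Longrightarrow> (fst (arc_pair n c k), snd (arc_pair n c k)) \<in> set (curve_arcs n c)"
  using arc_pair_mem by simp

text \<open>
  For a curve of positive letters, \<open>depth c p\<close> counts the crossings \<open>x\<close> with \<open>x < p \<le> flip x\<close>. Following the
  curve, it drops by one along each chord but the first and rises by one at each crossing, hence it vanishes on
  arrival at every ray.
\<close>

definition depth :: "point list \<Rightarrow> point \<Rightarrow> int" where
  "depth c p = (\<Sum>x\<in>set c. of_bool (x < p) - of_bool (flip x < p))"

text \<open>By \<open>curve_arc_balance\<close> the points strictly between the ends contribute
  nothing in total. Going right, passing the start \<open>a\<close> adds a term -1; going left, the
  crossing \<open>b\<close> is no longer counted. The base point is not a flip of a crossing, hence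
  the exception for the first chord.\<close>

lemma depth_snd_arc:
  assumes c: "curve n c" and pos: "\<forall>x\<in>set c. snd x < 0" and k: "k \<le> length c"
  shows "depth c (snd (arc_pair n c k)) = depth c (fst (arc_pair n c k)) - of_bool (k \<noteq> 0)"
proof -
  define a where "a = fst (arc_pair n c k)"
  define b where "b = snd (arc_pair n c k)"
  have ab: "(a, b) \<in> set (curve_arcs n c)" unfolding a_def b_def by (rule arc_pair_mem'[OF k])
  have rng: "1 \<le> fst x" "fst x \<le> n" if "x \<in> set c" for x using curve_range[OF c that] by auto
  have sa: "0 < snd a" and sb: "snd b < 0" using arcs_points[OF ab] pos by auto
  have na: "x \<noteq> a" and nb: "flip x \<noteq> b" if "x \<in> set c" for x using pos that sa sb by auto
  have bal: "(\<Sum>x\<in>set c. of_bool (btw a b x) - of_bool (btw a b (flip x)) :: int) = 0"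
    using curve_arc_balance[OF c ab] by (simp add: sum_subtractf)
  have one: "(\<Sum>x\<in>set c. of_bool (x = y) :: int) = 1" if "y \<in> set c" for y
    using that by (simp add: of_bool_def sum.delta)
  have lt: "of_bool (x < q) = of_bool (x < p) + of_bool (x = p) + (of_bool (btw p q x) :: int)"
    if "p < q" for p q x :: point
    using that unfolding btw_def by (cases x p rule: linorder_cases) auto
  consider "a < b" | "b < a" using sa sb by (metis less_asym linorder_neqE)
  then have "depth c b = depth c a - of_bool (k \<noteq> 0)"
  proof cases
    case 1
    have "depth c b = (\<Sum>x\<in>set c. (of_bool (x < a) - of_bool (flip x < a))
        + (of_bool (btw a b x) - of_bool (btw a b (flip x))) - of_bool (flip x = a))"
      unfolding depth_def by (intro sum.cong refl) (simp add: lt[OF 1] na)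
    also have "\<dots> = depth c a - (\<Sum>x\<in>set c. of_bool (flip x = a))"
      using bal by (simp add: depth_def sum.distrib sum_subtractf)
    also have "(\<Sum>x\<in>set c. of_bool (flip x = a)) = (of_bool (k \<noteq> 0) :: int)"
    proof (cases k)
      case 0
      then have "a = (0, 1)" by (simp add: a_def fst_arc_pair_0)
      then have "flip x \<noteq> a" if "x \<in> set c" for x using rng[OF that] by (auto simp: flip_def)
      then show ?thesis using 0 by simp
    next
      case (Suc k')
      then have "a = flip (c ! k')" "c ! k' \<in> set c" using k by (simp_all add: a_def fst_arc_pair_Suc)
      then show ?thesis using one[of "c ! k'"] Suc by simp
    qed
    finally show ?thesis .
  next
    case 2
    have kl: "k \<noteq> length c"
    proof
      assume "k = length c"
      then have "b = (Suc n, -1)" by (simp add: b_def snd_arc_pair_length)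
      then show False using 2 curve_arcs_ends_le[OF c ab] by auto
    qed
    have "k \<noteq> 0"
    proof
      assume "k = 0"
      then have "a = (0, 1)" by (simp add: a_def fst_arc_pair_0)
      then show False using 2 curve_arcs_ends_le[OF c ab] by auto
    qed
    have b: "b \<in> set c" using k kl by (simp add: b_def snd_arc_pair)
    have "depth c a = (\<Sum>x\<in>set c. (of_bool (x < b) - of_bool (flip x < b))
        + (of_bool (btw b a x) - of_bool (btw b a (flip x))) + of_bool (x = b))"
      unfolding depth_def by (intro sum.cong refl) (simp add: lt[OF 2] nb)
    also have "\<dots> = depth c b + 1"
      using bal one[OF b] by (simp add: depth_def sum.distrib sum_subtractf btw_commute[of b a])
    finally show ?thesis using \<open>k \<noteq> 0\<close> by simp
  qed
  then show ?thesis by (simp add: a_def b_def)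
qed

text \<open>A crossing of the same ray farther from the puncture encloses both \<open>y\<close> and
  \<open>flip y\<close>, a nearer one neither of them; only \<open>y\<close> itself changes its
  contribution.\<close>

lemma depth_flip:
  assumes "\<forall>x\<in>set c. snd x < 0" "y \<in> set c"
  shows "depth c (flip y) = depth c y + 1"
proof -
  have "of_bool (x < flip y) - of_bool (flip x < flip y)
      = of_bool (x < y) - of_bool (flip x < y) + (of_bool (x = y) :: int)" if "x \<in> set c" for x
  proof -
    have "snd x < 0" "snd y < 0" using assms that by auto
    then show ?thesis
      by (cases "fst x" "fst y" rule: linorder_cases; cases "snd x" "snd y" rule: linorder_cases)
        (auto simp: point_less_iff prod_eq_iff)
  qed
  then have "depth c (flip y) = depth c y + (\<Sum>x\<in>set c. of_bool (x = y))"
    unfolding depth_def by (simp add: sum.distrib)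
  also have "(\<Sum>x\<in>set c. of_bool (x = y) :: int) = 1"
    using assms(2) by (simp add: of_bool_def sum.delta)
  finally show ?thesis .
qed

lemma positive_curve_depth:
  assumes c: "curve n c" and pos: "\<forall>x\<in>set c. snd x < 0" and "k < length c"
  shows "depth c (c ! k) = 0"
  using assms(3)
proof (induction k)
  case 0
  have "\<not> x < (0, 1) \<and> \<not> flip x < (0, 1)" if "x \<in> set c" for x
    using curve_range[OF c that] by (simp add: point_less_iff)
  then have "depth c (0, 1) = 0" by (simp add: depth_def)
  then show ?case using depth_snd_arc[OF c pos, of 0] 0 by (simp add: fst_arc_pair_0 snd_arc_pair)
next
  case (Suc k)
  then show ?case using depth_snd_arc[OF c pos, of "Suc k"] depth_flip[OF pos, of "c ! k"]
    by (simp add: fst_arc_pair_Suc snd_arc_pair)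
qed

text \<open>All terms of the depth are nonnegative here, so its vanishing at a crossing kills each
  of them. Of two crossings of one ray, the farther would contribute 1 at the nearer.\<close>

lemma positive_curve_distinct:
  assumes c: "curve n c" and pos: "\<forall>x\<in>set c. snd x < 0"
  shows "distinct (map fst c)"
proof -
  have no: "\<not> (y < x \<and> x \<le> flip y)" if x: "x \<in> set c" and y: "y \<in> set c" for x y
  proof -
    have "y < flip y" if "y \<in> set c" for y using pos that by (simp add: point_less_iff)
    then have nonneg: "0 \<le> (of_bool (y < x) - of_bool (flip y < x) :: int)" if "y \<in> set c" for y
      using less_trans[of y "flip y" x] that by (auto simp: of_bool_def)
    obtain k where "k < length c" "x = c ! k" using x by (metis in_set_conv_nth)
    then have "depth c x = 0" using positive_curve_depth[OF c pos] by simp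
    then have "(\<Sum>y\<in>set c. of_bool (y < x) - of_bool (flip y < x) :: int) = 0" unfolding depth_def .
    then have "of_bool (y < x) - of_bool (flip y < x) = (0::int)"
      by (rule sum_nonneg_0[OF finite_set _ _ y, rotated]) (rule nonneg)
    then show ?thesis by (auto simp: of_bool_def split: if_splits)
  qed
  have "inj_on fst (set c)"
  proof (rule inj_onI, rule ccontr)
    fix x y assume xy: "x \<in> set c" "y \<in> set c" "fst x = fst y" "x \<noteq> y"
    then have "snd x < 0" "snd y < 0" using pos by auto
    then have "x \<le> flip y" "y \<le> flip x" using xy(3) by (auto simp: point_less_iff intro: less_imp_le)
    then show False using no[OF xy(1,2)] no[OF xy(2,1)] xy(4) by (metis linorder_neqE)
  qed
  then show ?thesis using curve_distinct[OF c] by (simp add: distinct_map)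
qed

text \<open>The invariant \<open>inv\<close> keeps the remaining crossings to the right of the start
  of chord \<open>k\<close>. If one of them lay to the left of the end of that chord, its right side
  would be trapped below the chord.\<close>

lemma positive_curve_increasing:
  assumes c: "curve n c" and pos: "\<forall>x\<in>set c. snd x < 0"
  shows "sorted_wrt (<) (map fst c)"
proof -
  have d: "distinct (map fst c)" using positive_curve_distinct[OF c pos] .
  have rng: "1 \<le> fst (c ! k)" "snd (c ! k) < 0" if "k < length c" for k
    using curve_range[OF c, of "c ! k"] pos that by auto
  have inv: "\<forall>k'. k \<le> k' \<and> k' < length c \<longrightarrow> fst (fst (arc_pair n c k)) < fst (c ! k')" if "k \<le> length c" for k
    using that
  proof (induction k)
    case 0
    then show ?case using rng(1) by (simp add: fst_arc_pair_0 Suc_le_eq)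
  next
    case (Suc k)
    define a where "a = fst (arc_pair n c k)"
    define b where "b = snd (arc_pair n c k)"
    have kl: "k < length c" using Suc.prems by simp
    have ab: "(a, b) \<in> set (curve_arcs n c)" unfolding a_def b_def using kl by (intro arc_pair_mem') simp
    have b: "b = c ! k" using kl by (simp add: b_def snd_arc_pair)
    have low: "fst a < fst (c ! k')" if "k \<le> k'" "k' < length c" for k'
      using Suc.IH kl that by (simp add: a_def)
    have "a < b" using low[of k] kl b by (simp add: point_less_iff)
    \<comment> \<open>The ends below the chord would be closed under following the curve backwards to the base point.\<close>
    have closed: "\<not> btw a b (fst (arc_pair n c k'))" if "k' \<le> length c" for k'
      using that
    proof (induction k')
      case 0
      then show ?case using curve_arcs_ends_le[OF c ab] unfolding btw_iff by (auto simp: fst_arc_pair_0)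
    next
      case (Suc k')
      have k'l: "k' < length c" using Suc.prems by simp
      show ?case
      proof
        assume "btw a b (fst (arc_pair n c (Suc k')))"
        then have bt: "a < flip (c ! k')" "flip (c ! k') < b"
          using k'l \<open>a < b\<close> by (auto simp: fst_arc_pair_Suc btw_def)
        \<comment> \<open>The right side of the ray of \<open>b\<close> lies beyond
          \<open>b\<close>, and the ray of \<open>a\<close> is crossed only at \<open>a\<close>,
          which is not below the chord. On any other ray, both sides of a crossing are below the
          chord together.\<close>
        have "fst (c ! k') \<noteq> fst b"
          using bt(2) rng[OF k'l] rng[OF kl] b by (auto simp: point_less_iff)
        moreover have "fst a \<noteq> fst (c ! k')"
        proof
          assume eq: "fst a = fst (c ! k')"
          show False
          proof (cases k)
            case 0
            then show False using eq rng[OF k'l] by (simp add: a_def fst_arc_pair_0)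
          next
            case (Suc l)
            then have "a = flip (c ! l)" "l < length c" using kl by (simp_all add: a_def fst_arc_pair_Suc)
            then have "l = k'" using d eq k'l by (simp add: distinct_conv_nth) (metis)
            then show False using bt(1) \<open>a = flip (c ! l)\<close> by simp
          qed
        qed
        ultimately have "a < c ! k'" "c ! k' < b" using bt by (auto simp: point_less_iff)
        then have "btw a b (snd (arc_pair n c k'))" using k'l \<open>a < b\<close> by (simp add: snd_arc_pair btw_def)
        then have "btw a b (fst (arc_pair n c k'))"
          using noncrossingD[OF curve_noncrossing[OF c] ab arc_pair_mem'[of k' c n]] k'l by simp
        then show False using Suc.IH k'l by simp
      qed
    qed
    show ?case
    proof (intro allI impI)
      fix k' assume k': "Suc k \<le> k' \<and> k' < length c"
      then have "fst (c ! k') \<noteq> fst (c ! k)" using d kl by (auto simp: distinct_conv_nth)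
      moreover have "\<not> fst (c ! k') < fst (c ! k)"
      proof
        assume "fst (c ! k') < fst (c ! k)"
        then have "a < flip (c ! k')" "flip (c ! k') < b" using low[of k'] k' b by (auto simp: point_less_iff)
        then have "btw a b (fst (arc_pair n c (Suc k')))"
          using k' \<open>a < b\<close> by (simp add: fst_arc_pair_Suc btw_def)
        then show False using closed[of "Suc k'"] k' by simp
      qed
      ultimately show "fst (fst (arc_pair n c (Suc k))) < fst (c ! k')"
        using kl by (simp add: fst_arc_pair_Suc)
    qed
  qed
  have "fst (c ! k) < fst (c ! k')" if "k < k'" "k' < length c" for k k'
    using inv[of "Suc k"] that by (simp add: fst_arc_pair_Suc)
  then show ?thesis by (simp add: sorted_wrt_iff_nth_less)
qed

text \<open>Consider the chord leaving the base point. Flips precede their crossings here, so a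
  crossing below this chord has its flip below it as well; the flip of the chord's own end is also
  below, which contradicts the balance.\<close>

lemma no_negative_curve:
  assumes c: "curve n c" and neg: "\<forall>x\<in>set c. 0 < snd x"
  shows "c = []"
proof (rule ccontr)
  assume "c \<noteq> []"
  define b where "b = c ! 0"
  have ab: "((0, 1), b) \<in> set (curve_arcs n c)"
    using arc_pair_mem'[of 0 c n] \<open>c \<noteq> []\<close> by (simp add: fst_arc_pair_0 snd_arc_pair b_def)
  have b: "b \<in> set c" "0 < snd b" using \<open>c \<noteq> []\<close> neg by (auto simp: b_def)
  have sb: "(0, 1) < b" using curve_arcs_ends_le[OF c ab] by simp
  have st: "(0, 1) < x" "(0, 1) < flip x" if "x \<in> set c" for x
    using curve_range[OF c that] by (auto simp: point_less_iff)
  have "(\<Sum>x\<in>set c. of_bool (btw (0, 1) b x)) < (\<Sum>x\<in>set c. of_bool (btw (0, 1) b (flip x)) :: int)"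
  proof (rule sum_strict_mono_ex1)
    show "\<forall>x\<in>set c. of_bool (btw (0, 1) b x) \<le> (of_bool (btw (0, 1) b (flip x)) :: int)"
    proof
      fix x assume x: "x \<in> set c"
      have "flip x < x" using neg x by (simp add: point_less_iff)
      then have "btw (0, 1) b x \<Longrightarrow> btw (0, 1) b (flip x)"
        using st[OF x] sb unfolding btw_def by (auto dest: less_trans)
      then show "of_bool (btw (0, 1) b x) \<le> (of_bool (btw (0, 1) b (flip x)) :: int)" by (simp add: of_bool_def)
    qed
    have "flip b < b" using b by (simp add: point_less_iff)
    then have "btw (0, 1) b (flip b)" using st[OF b(1)] sb by (simp add: btw_def)
    then show "\<exists>x\<in>set c. of_bool (btw (0, 1) b x) < (of_bool (btw (0, 1) b (flip x)) :: int)"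
      using b(1) by (intro bexI[of _ b]) simp_all
  qed simp
  then show False using curve_arc_balance[OF c ab] by simp
qed

section \<open>Orbits of planar words\<close>

lemma braid_pair_id: "braid_pair n gen gen"
proof -
  have "ext gen (tprod n) = tprod n"
    using tprod_carrier[of n n] by (simp add: ext_eq subst_gen_id reduce_carrier)
  moreover have "over n (gen i) \<and> reduced (gen i) \<and> (\<exists>j\<in>{1..n}. \<exists>h. over n h \<and> gen i \<approx> h @ gen j @ inv_word h)"
    if "i \<in> {1..n}" for i
    using that by (intro conjI bexI[of _ i] exI[of _ "[]"]) (auto simp: gen_def)
  ultimately show ?thesis by (simp add: braid_pair_def braid_map_def subst_gen)
qed

lemma tprod_Suc: "tprod (Suc r) = tprod r @ [(Suc r, False)]"
  by (simp add: tprod_def)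

text \<open>Let the prefix \<open>tprod r\<close> grow: \<open>left_move (Suc r) j\<close> sends
  \<open>t_j\<close> to the next generator and fixes the prefix and all letters beyond
  \<open>j\<close>. The letters that it would conjugate do not occur, the list being
  increasing.\<close>

lemma increasing_word_orbit:
  assumes "sorted_wrt (<) ls" "\<forall>l\<in>set ls. r < l \<and> l \<le> n" "r \<le> n"
  shows "\<exists>k\<le>n. \<exists>f g. braid_pair n f g \<and> ext f (tprod k) = tprod r @ map (\<lambda>l. (l, False)) ls"
  using assms
proof (induction ls arbitrary: r)
  case Nil
  have "ext gen (tprod r) = tprod r"
    using tprod_carrier[OF Nil.prems(3)] by (simp add: ext_eq subst_gen_id reduce_carrier)
  then show ?case using Nil.prems(3) braid_pair_id by auto
next
  case (Cons j ls)
  let ?m = "map (\<lambda>l. (l, False))"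
  have j: "Suc r \<le> j" "j \<le> n" and ls: "\<forall>l\<in>set ls. j < l \<and> l \<le> n" using Cons.prems by auto
  then have ls': "\<forall>l\<in>set ls. Suc r < l \<and> l \<le> n" by auto
  have "\<exists>k\<le>n. \<exists>f g. braid_pair n f g \<and> ext f (tprod k) = tprod (Suc r) @ ?m ls"
    using Cons.IH[OF _ ls'] Cons.prems j by simp
  then obtain k where k: "k \<le> n" "\<exists>f g. braid_pair n f g \<and> ext f (tprod k) = tprod (Suc r) @ ?m ls" by blast
  show ?case
  proof (cases "j = Suc r")
    case True
    then show ?thesis using k by (auto simp: tprod_Suc)
  next
    case False
    let ?f = "left_move (Suc r) j"
    have bp: "braid_pair n ?f (right_move (Suc r) j)"
      using j False by (intro braid_pair_left_move) auto
    have "subst ?f (tprod r) = tprod r"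
      unfolding tprod_def by (rule subst_gen_eqs) (use j in \<open>auto simp: left_move_def\<close>)
    moreover have "subst ?f (?m ls) = ?m ls"
      by (rule subst_gen_eqs) (use ls j in \<open>auto simp: left_move_def\<close>)
    moreover have "subst ?f [(j, False)] = [(Suc r, False)]"
      by (simp add: subst_Cons left_move_def gen_def)
    ultimately have "subst ?f (tprod r @ [(j, False)] @ ?m ls) = tprod (Suc r) @ ?m ls"
      by (simp only: subst_append tprod_Suc append_assoc)
    moreover have "reduced (tprod (Suc r) @ ?m ls)" by (rule reduced_positive) (auto simp: tprod_def)
    ultimately have e: "ext ?f (tprod r @ ?m (j # ls)) = tprod (Suc r) @ ?m ls"
      by (simp add: ext_eq reduce_reduced)
    have "reduced (tprod r @ ?m (j # ls))" by (rule reduced_positive) (auto simp: tprod_def)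
    moreover have "over n (tprod r @ ?m (j # ls))"
      using tprod_carrier[OF Cons.prems(3)] j ls by (auto simp: carrier_iff over_def)
    ultimately have "tprod r @ ?m (j # ls) \<in> carrier n" by (simp add: carrier_iff)
    from orbit_pull_back[OF bp this, of "tprod k"] k show ?thesis unfolding e by blast
  qed
qed

text \<open>Consecutive crossings in opposite directions are joined by a chord between equal sides,
  so without such chords the sign propagates along the curve.\<close>

lemma curve_sign_cases:
  assumes c: "curve n c" and none: "\<not> (\<exists>r\<in>set (curve_arcs n c). lower_arc n r \<or> upper_arc r)"
  shows "(\<forall>x\<in>set c. snd x < 0) \<or> (\<forall>x\<in>set c. 0 < snd x)"
proof -
  have rng: "1 \<le> fst (c ! k)" "fst (c ! k) \<le> n" "snd (c ! k) \<noteq> 0" if "k < length c" for k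
    using curve_range[OF c, of "c ! k"] that by auto
  have step: "0 < snd (c ! Suc k) \<longleftrightarrow> 0 < snd (c ! k)" if "Suc k < length c" for k
  proof -
    have "(flip (c ! k), c ! Suc k) \<in> set (curve_arcs n c)"
      using arc_pair_mem'[of "Suc k" c n] that by (simp add: fst_arc_pair_Suc snd_arc_pair)
    then have "\<not> lower_arc n (flip (c ! k), c ! Suc k)" "\<not> upper_arc (flip (c ! k), c ! Suc k)"
      using none by blast+
    then show ?thesis using rng[of k] rng[of "Suc k"] that by (auto simp: lower_arc_def upper_arc_def)
  qed
  have "0 < snd (c ! k) \<longleftrightarrow> 0 < snd (c ! 0)" if "k < length c" for k
    using that by (induction k) (auto simp: step)
  then show ?thesis using rng by (metis in_set_conv_nth linorder_neqE)
qed

lemma curve_word_orbit: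
  "curve n c \<Longrightarrow> reduced (word_of c) \<Longrightarrow> \<exists>k\<le>n. \<exists>f g. braid_pair n f g \<and> ext f (tprod k) = word_of c"
proof (induction "length c" arbitrary: c rule: less_induct)
  case less
  note c = less.prems(1)
  have car: "word_of c \<in> carrier n" using less.prems over_word_of[OF c] by (simp add: carrier_iff)
  show ?case
  proof (cases "\<exists>r\<in>set (curve_arcs n c). lower_arc n r \<or> upper_arc r")
    case True
    obtain f g c' where fg: "braid_pair n f g" "curve n c'" "word_of c' = ext f (word_of c)" "length c' < length c"
      using curve_shorten[OF c less.prems(2) True] .
    have "reduced (word_of c')" unfolding fg(3) ext_eq by simp
    then obtain k where "k \<le> n" "\<exists>f' g'. braid_pair n f' g' \<and> ext f' (tprod k) = ext f (word_of c)"
      using less.hyps[OF fg(4,2)] fg(3) by auto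
    then show ?thesis using orbit_pull_back[OF fg(1) car] by blast
  next
    case False
    from curve_sign_cases[OF c False] have pos: "\<forall>x\<in>set c. snd x < 0"
    proof
      assume "\<forall>x\<in>set c. 0 < snd x"
      then show ?thesis using no_negative_curve[OF c] by simp
    qed
    have "\<forall>l\<in>set (map fst c). 0 < l \<and> l \<le> n" using curve_range[OF c] by (simp add: Suc_le_eq)
    then obtain k where "k \<le> n"
      "\<exists>f g. braid_pair n f g \<and> ext f (tprod k) = tprod 0 @ map (\<lambda>l. (l, False)) (map fst c)"
      using increasing_word_orbit[OF positive_curve_increasing[OF c pos], of 0 n] by auto
    moreover have "tprod 0 @ map (\<lambda>l. (l, False)) (map fst c) = word_of c"
      using pos by (fastforce simp: tprod_def word_of_def)
    ultimately show ?thesis by auto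
  qed
qed

text \<open>The expansion reads \<open>0, 1, ..., 2k, 2n + 1\<close> and is already increasing, so
  the identity serves as the permutation; paired positions are neighbours, which makes the pairs
  nested.\<close>

lemma planar_tprod:
  assumes "k \<le> n"
  shows "planar_word n (tprod k)"
proof -
  have code: "whitehead n (tprod k) ! i = (if i = 2 * k + 1 then 2 * n + 1 else i)" if "i < 2 * k + 2" for i
  proof -
    have len: "length (tprod k) = k" and nth: "\<And>l. l < k \<Longrightarrow> tprod k ! l = (Suc l, False)"
      by (simp_all add: tprod_def del: upt_Suc)
    have "i = 0 \<or> i = 2 * k + 1 \<or> (\<exists>l<k. i = 2 * l + 1) \<or> (\<exists>l<k. i = 2 * l + 2)"
      using that by presburger
    then consider "i = 0" | l where "i = 2 * l + 1" "l < k" | l where "i = 2 * l + 2" "l < k" | "i = 2 * k + 1"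
      by blast
    then show ?thesis
    proof cases
      case (2 l)
      then show ?thesis using nth_whitehead(1)[of l "tprod k" n] len nth by (simp add: code_def)
    next
      case (3 l)
      then show ?thesis using nth_whitehead(2)[of l "tprod k" n] len nth by (simp add: code_def)
    qed (use nth_whitehead_ends[of n "tprod k"] len in simp_all)
  qed
  have len: "length (whitehead n (tprod k)) = 2 * (k + 1)"
    by (simp add: length_whitehead tprod_def del: upt_Suc)
  have mono: "whitehead n (tprod k) ! (i - 1) \<le> whitehead n (tprod k) ! (j - 1)"
    if "i \<in> {1..2 * (k + 1)}" "j \<in> {1..2 * (k + 1)}" "i < j" for i j
    using that code[of "i - 1"] code[of "j - 1"] assms by auto
  have n1: "nested (2*i-1) (2*i) (2*j-1) (2*j)" if "i \<in> {1..k+1}" "j \<in> {1..k+1}" "i \<noteq> j" for i j :: nat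
    using that by (auto simp: nested_def between_def)
  have n2: "nested (2*i) (2*i+1) (2*j) (2*j+1)" if "i \<noteq> j" for i j :: nat
    using that by (auto simp: nested_def between_def)
  show ?thesis unfolding planar_word_def planar_tuple_def len Let_def
    using mono n1 n2 by (intro conjI exI[of _ id]) auto
qed

theorem theoremA:
  fixes n :: nat
  shows "(\<forall>k\<le>n. tprod k \<in> carrier n \<and> planar_word n (tprod k))
       \<and> (\<forall>w\<in>carrier n. planar_word n w \<longrightarrow> (\<exists>!k. k \<le> n \<and> w \<in> orbit n (tprod k)))"
proof (intro conjI allI impI ballI)
  fix k assume "k \<le> n"
  then show "tprod k \<in> carrier n" "planar_word n (tprod k)" by (rule tprod_carrier, rule planar_tprod)
next
  fix w assume w: "w \<in> carrier n" "planar_word n w"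
  obtain c where c: "curve n c" "word_of c = w"
    using planar_word_imp_curve[OF w(2)] w(1) unfolding carrier_iff by blast
  then obtain k f g where k: "k \<le> n" "braid_pair n f g" "ext f (tprod k) = w"
    using curve_word_orbit[OF c(1)] w(1) unfolding carrier_iff by blast
  then have "w \<in> orbit n (tprod k)" using braid_pair_imp_Bn[OF k(2)] by (auto simp: orbit_def)
  then show "\<exists>!k. k \<le> n \<and> w \<in> orbit n (tprod k)"
    using k(1) orbit_tprod_unique by blast
qed

end
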